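(* Let $\vec u$ be the solution of $-E\vec u''(x)+A(x)\vec u(x)=\vec f(x)$, $x\in(0,1)$, with $\vec u(0)$ and $\vec u(1)$ given, and let $\vec U$ be the solution of the finite difference scheme $-E\delta^2\vec U(x_j)+A(x_j)\vec U(x_j)=\vec f(x_j)$, $1\le j\le N-1$, $\vec U(0)=\vec u(0)$, $\vec U(1)=\vec u(1)$, on the piecewise uniform Shishkin mesh $\{x_j\}_{j=0}^N$ described in the context. Then there exists a constant $C$, independent of $N$ and of $\varepsilon_1,\dots,\varepsilon_n$, such that $$\|\vec U-\vec u\|\le C N^{-1}\ln N$$ for all (admissible) $N>1$, where $\|\vec U-\vec u\|=\max_{1\le i\le n}\max_{0\le j\le N}|U_i(x_j)-u_i(x_j)|$.
   Context: Problem data: $n\ge 1$, an $n\times n$ matrix function $A=(a_{ij})$ on $[0,1]$, $\vec f:[0,1]\to\mathbb R^n$, and boundary values $\vec u(0),\vec u(1)\in\mathbb R^n$ are fixed; $A$ and $\vec f$ are as many times continuously differentiable on $[0,1]$ as required. For all $x\in[0,1]$ and $1\le i\le n$: $a_{ii}(x)>\sum_{j\ne i}|a_{ij}(x)|$ and $a_{ij}(x)\le 0$ for $i\ne j$. The number $\alpha$ is fixed with $0<\alpha<\min_{x\in[0,1],\,1\le i\le n}\sum_{j=1}^n a_{ij}(x)$. The singular perturbation parameters satisfy $0<\varepsilon_1<\dots<\varepsilon_n\le 1$ and $\max_i\sqrt{\varepsilon_i}\le\sqrt\alpha/4$, and $E=\mathrm{diag}(\varepsilon_1,\dots,\varepsilon_n)$.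 The constant $C$ may depend on $n,A,\vec f,\alpha,\vec u(0),\vec u(1)$ only. Mesh: set $\sigma_n=\min\{\tfrac14,\sqrt{\varepsilon_n/\alpha}\,\ln N\}$ and, for $i=n-1,\dots,1$, $\sigma_i=\min\{\tfrac{\sigma_{i+1}}2,\sqrt{\varepsilon_i/\alpha}\,\ln N\}$. On $(\sigma_n,1-\sigma_n]$ a uniform mesh with $N/2$ intervals is placed; on each of $(\sigma_i,\sigma_{i+1}]$ and $(1-\sigma_{i+1},1-\sigma_i]$, $i=1,\dots,n-1$, a uniform mesh with $N/2^{n-i+2}$ intervals; on each of $[0,\sigma_1]$ and $(1-\sigma_1,1]$ a uniform mesh with $N/2^{n+1}$ intervals. $N$ is admissible if all these numbers are positive integers. The mesh points are $0=x_0<x_1<\dots<x_N=1$. Difference operators: $h_j=x_j-x_{j-1}$, $\overline h_j=(h_j+h_{j+1})/2$, $D^+\vec U(x_j)=(\vec U(x_{j+1})-\vec U(x_j))/h_{j+1}$, $D^-\vec U(x_j)=(\vec U(x_j)-\vec U(x_{j-1}))/h_j$, $\delta^2\vec U(x_j)=(D^+\vec U(x_j)-D^-\vec U(x_j))/\overline h_j$. *)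

theory Defs
  imports "HOL-Analysis.Analysis"
begin

(* Vectors in R^n and n x n matrices are indexed by {1..n} and given as functions on nat;
   values at other indices are never used. *)

(* g is k times continuously differentiable on [a,b], with one-sided derivatives at the
   endpoints; D m is the m-th derivative. *)
definition Ck_on :: "nat \<Rightarrow> real \<Rightarrow> real \<Rightarrow> (real \<Rightarrow> real) \<Rightarrow> bool" where
  "Ck_on k a b g \<longleftrightarrow>
    (\<exists>D :: nat \<Rightarrow> real \<Rightarrow> real.
      (\<forall>x\<in>{a..b}. D 0 x = g x) \<and>
      (\<forall>m<k. \<forall>x\<in>{a..b}. (D m has_real_derivative D (Suc m) x) (at x within {a..b})) \<and>
      (\<forall>m\<le>k. continuous_on {a..b} (D m)))"

definition problem_data ::
  "nat \<Rightarrow> nat \<Rightarrow> (nat \<Rightarrow> nat \<Rightarrow> real \<Rightarrow> real) \<Rightarrow> (nat \<Rightarrow> real \<Rightarrow> real) \<Rightarrow> real \<Rightarrow> bool" where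
  "problem_data n k a f \<alpha> \<longleftrightarrow>
    (\<forall>i\<in>{1..n}. \<forall>j\<in>{1..n}. Ck_on k 0 1 (a i j)) \<and>
    (\<forall>i\<in>{1..n}. Ck_on k 0 1 (f i)) \<and>
    (\<forall>x\<in>{0..1}. \<forall>i\<in>{1..n}. a i i x > (\<Sum>j\<in>{1..n} - {i}. \<bar>a i j x\<bar>)) \<and>
    (\<forall>x\<in>{0..1}. \<forall>i\<in>{1..n}. \<forall>j\<in>{1..n}. i \<noteq> j \<longrightarrow> a i j x \<le> 0) \<and>
    0 < \<alpha> \<and>
    (\<forall>x\<in>{0..1}. \<forall>i\<in>{1..n}. \<alpha> < (\<Sum>j\<in>{1..n}. a i j x))"

definition perturbation_params :: "nat \<Rightarrow> real \<Rightarrow> (nat \<Rightarrow> real) \<Rightarrow> bool" where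
  "perturbation_params n \<alpha> \<epsilon> \<longleftrightarrow>
    (\<forall>i\<in>{1..n}. 0 < \<epsilon> i \<and> \<epsilon> i \<le> 1) \<and>
    strict_mono_on {1..n} \<epsilon> \<and>
    (MAX i\<in>{1..n}. sqrt (\<epsilon> i)) \<le> sqrt \<alpha> / 4"

definition bvp_solution ::
  "nat \<Rightarrow> (nat \<Rightarrow> nat \<Rightarrow> real \<Rightarrow> real) \<Rightarrow> (nat \<Rightarrow> real \<Rightarrow> real) \<Rightarrow>
   (nat \<Rightarrow> real) \<Rightarrow> (nat \<Rightarrow> real) \<Rightarrow> (nat \<Rightarrow> real) \<Rightarrow> (nat \<Rightarrow> real \<Rightarrow> real) \<Rightarrow> bool" where
  "bvp_solution n a f u0 u1 \<epsilon> u \<longleftrightarrow>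
    (\<forall>i\<in>{1..n}. continuous_on {0..1} (u i) \<and> u i 0 = u0 i \<and> u i 1 = u1 i \<and>
      (\<exists>u' u''. \<forall>x\<in>{0<..<1}.
        (u i has_real_derivative u' x) (at x) \<and>
        (u' has_real_derivative u'' x) (at x) \<and>
        - \<epsilon> i * u'' x + (\<Sum>j\<in>{1..n}. a i j x * u j x) = f i x))"

(* Transition points; only used for i in {1..n}. *)
function transition_point :: "nat \<Rightarrow> real \<Rightarrow> (nat \<Rightarrow> real) \<Rightarrow> nat \<Rightarrow> nat \<Rightarrow> real" where
  "transition_point n \<alpha> \<epsilon> N i =
    (if i < n then min (transition_point n \<alpha> \<epsilon> N (Suc i) / 2) (sqrt (\<epsilon> i / \<alpha>) * ln (real N))
     else min (1/4) (sqrt (\<epsilon> n / \<alpha>) * ln (real N)))"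
  by pat_completeness auto
termination by (relation "Wellfounded.measure (\<lambda>(n, _, _, _, i). n - i)") auto

declare transition_point.simps [simp del]

definition admissible :: "nat \<Rightarrow> nat \<Rightarrow> bool" where
  "admissible n N \<longleftrightarrow>
    0 < N \<and> 2 dvd N \<and> (\<forall>i\<in>{1..<n}. 2 ^ (n - i + 2) dvd N) \<and> 2 ^ (n + 1) dvd N"

(* Points of the uniform mesh with M intervals, both endpoints included. *)
definition uniform_mesh :: "real \<Rightarrow> real \<Rightarrow> nat \<Rightarrow> real set" where
  "uniform_mesh a b M = (\<lambda>k. a + real k * ((b - a) / real M)) ` {0..M}"

definition shishkin_points :: "nat \<Rightarrow> real \<Rightarrow> (nat \<Rightarrow> real) \<Rightarrow> nat \<Rightarrow> real set" where
  "shishkin_points n \<alpha> \<epsilon> N =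
    (let \<sigma> = transition_point n \<alpha> \<epsilon> N in
      uniform_mesh 0 (\<sigma> 1) (N div 2 ^ (n + 1)) \<union>
      (\<Union>i\<in>{1..<n}. uniform_mesh (\<sigma> i) (\<sigma> (i + 1)) (N div 2 ^ (n - i + 2))) \<union>
      uniform_mesh (\<sigma> n) (1 - \<sigma> n) (N div 2) \<union>
      (\<Union>i\<in>{1..<n}. uniform_mesh (1 - \<sigma> (i + 1)) (1 - \<sigma> i) (N div 2 ^ (n - i + 2))) \<union>
      uniform_mesh (1 - \<sigma> 1) 1 (N div 2 ^ (n + 1)))"

(* The mesh points in increasing order, numbered from 0; for admissible N > 1 there are
   N + 1 of them. *)
definition shishkin_mesh :: "nat \<Rightarrow> real \<Rightarrow> (nat \<Rightarrow> real) \<Rightarrow> nat \<Rightarrow> nat \<Rightarrow> real" where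
  "shishkin_mesh n \<alpha> \<epsilon> N j = sorted_list_of_set (shishkin_points n \<alpha> \<epsilon> N) ! j"

(* A mesh function is given by its values V j at the mesh points x j. *)

definition Dplus :: "(nat \<Rightarrow> real) \<Rightarrow> (nat \<Rightarrow> real) \<Rightarrow> nat \<Rightarrow> real" where
  "Dplus x V j = (V (j + 1) - V j) / (x (j + 1) - x j)"

definition Dminus :: "(nat \<Rightarrow> real) \<Rightarrow> (nat \<Rightarrow> real) \<Rightarrow> nat \<Rightarrow> real" where
  "Dminus x V j = (V j - V (j - 1)) / (x j - x (j - 1))"

definition delta2 :: "(nat \<Rightarrow> real) \<Rightarrow> (nat \<Rightarrow> real) \<Rightarrow> nat \<Rightarrow> real" where
  "delta2 x V j =
    (Dplus x V j - Dminus x V j) / (((x j - x (j - 1)) + (x (j + 1) - x j)) / 2)"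

definition scheme_solution ::
  "nat \<Rightarrow> (nat \<Rightarrow> nat \<Rightarrow> real \<Rightarrow> real) \<Rightarrow> (nat \<Rightarrow> real \<Rightarrow> real) \<Rightarrow>
   (nat \<Rightarrow> real) \<Rightarrow> (nat \<Rightarrow> real) \<Rightarrow> (nat \<Rightarrow> real) \<Rightarrow> nat \<Rightarrow> (nat \<Rightarrow> real) \<Rightarrow>
   (nat \<Rightarrow> nat \<Rightarrow> real) \<Rightarrow> bool" where
  "scheme_solution n a f u0 u1 \<epsilon> N x U \<longleftrightarrow>
    (\<forall>i\<in>{1..n}. U i 0 = u0 i \<and> U i N = u1 i \<and>
      (\<forall>j\<in>{1..N - 1}.
        - \<epsilon> i * delta2 x (U i) j + (\<Sum>l\<in>{1..n}. a i l (x j) * U l j) = f i (x j)))"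

definition max_error ::
  "nat \<Rightarrow> nat \<Rightarrow> (nat \<Rightarrow> real) \<Rightarrow> (nat \<Rightarrow> nat \<Rightarrow> real) \<Rightarrow> (nat \<Rightarrow> real \<Rightarrow> real) \<Rightarrow> real" where
  "max_error n N x U u = (MAX i\<in>{1..n}. MAX j\<in>{0..N}. \<bar>U i j - u i (x j)\<bar>)"

end

theory Submission
  imports Defs
begin

text \<open>By the mean value form of the second divided difference, the truncation error in the \<open>i\<close>-th
  equation is the difference of two values of \<open>\<epsilon> i * u'' i = (A u - f) i\<close> inside
  \<open>[x (j - 1), x (j + 1)]\<close>. It is therefore bounded by the oscillation of the solution over mesh
  intervals, and no derivative estimates beyond first order are needed, not even where the mesh
  width changes. A barrier function for the increments \<open>u (x + h) - u x\<close> yields the bound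
  \<open>h + (\<Sum>p. min 1 (h / sqrt (\<epsilon> p)) * (exp (- sqrt (\<alpha> / \<epsilon> p) * x) + exp (- sqrt (\<alpha> / \<epsilon> p) * (1 - (x + h)))))\<close>
  for this oscillation, up to a constant factor. On every interval of the Shishkin mesh and for every
  \<open>p\<close>, either \<open>h / sqrt (\<epsilon> p)\<close> is of order \<open>ln N / N\<close> or both exponentials are at most \<open>1 / N\<close>.
  The discrete maximum principle turns the bound on the truncation error into one on the error.\<close>

section \<open>Comparison principles\<close>

text \<open>Bounding oscillations loses nothing here, because the target rate is itself the size of
  the oscillation: over one mesh interval the solution varies by at most a multiple of
  \<open>ln N / N\<close>, and \<open>A u - f\<close> inherits this since \<open>A\<close> and
  \<open>f\<close> are Lipschitz. Cancellation inside the second difference would matter only for a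
  higher rate. The price is a bound on increments that is uniform in all ratios of the parameters.
  Subtracting the system at \<open>t\<close> from the one at \<open>t + h\<close> leaves a
  right-hand side of order \<open>h\<close>. At the two ends of \<open>[0, 1 - h]\<close>, component
  \<open>i\<close> of the increment is of order \<open>min 1 (h / sqrt (\<epsilon> i))\<close>,
  because \<open>\<epsilon> i * u'' i\<close> is bounded. The barrier has to dominate these end
  values and decay at the rates \<open>sqrt (\<alpha> / \<epsilon> p)\<close>. The coupling is the
  obstacle: a fast layer acts on every slower component, and the constants must not degenerate when
  two scales approach each other.\<close>

lemma second_derivative_nonneg_at_min:
  fixes g :: "real \<Rightarrow> real"
  assumes x: "x \<in> {l<..<r}"
    and g': "\<And>y. y \<in> {l<..<r} \<Longrightarrow> (g has_real_derivative g' y) (at y)"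
    and g'': "(g' has_real_derivative d) (at x)"
    and min: "\<And>y. y \<in> {l<..<r} \<Longrightarrow> g x \<le> g y"
  shows "0 \<le> d"
proof (rule ccontr)
  assume "\<not> 0 \<le> d"
  then have "d < 0" by simp
  have x0: "g' x = 0"
  proof (rule DERIV_local_min[OF g'[OF x]])
    show "0 < min (x - l) (r - x)" using x by simp
    show "\<forall>y. \<bar>x - y\<bar> < min (x - l) (r - x) \<longrightarrow> g x \<le> g y"
      using min by (auto simp: abs_if split: if_splits)
  qed
  \<comment> \<open>A negative second derivative makes \<open>g'\<close> negative immediately to the
    right of its zero \<open>x\<close>, so \<open>g\<close> would drop below its minimum.\<close>
  obtain e where e: "e > 0" "\<And>h. 0 < h \<Longrightarrow> h < e \<Longrightarrow> g' (x + h) < g' x"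
    using DERIV_neg_dec_right[OF g'' \<open>d < 0\<close>] by auto
  define y where "y = x + min (e / 2) ((r - x) / 2)"
  have y: "x < y" "y < r" "y < x + e"
    using e(1) x by (auto simp: y_def min_def field_simps)
  have "g y < g x"
  proof (rule DERIV_neg_imp_decreasing_open[OF y(1)])
    fix z assume z: "x < z" "z < y"
    show "\<exists>D. (g has_real_derivative D) (at z) \<and> D < 0"
      using g'[of z] e(2)[of "z - x"] z y x x0 by auto
  next
    show "continuous_on {x..y} g"
    proof (rule DERIV_continuous_on)
      fix z assume "z \<in> {x..y}"
      then have "z \<in> {l<..<r}" using x y by auto
      then show "(g has_real_derivative g' z) (at z within {x..y})"
        by (rule has_field_derivative_at_within[OF g'])
    qed
  qed
  with min[of y] x y show False by auto
qed

text \<open>At a negative minimum over all components and points, each off-diagonal entry, being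
  nonpositive, multiplies a value at least as large as the minimum. The zero-order term is thus at
  most the row sum times the minimum, hence negative, while the diffusion term is nonpositive
  there.\<close>

lemma system_maximum_principle:
  fixes z z' z'' :: "'i \<Rightarrow> real \<Rightarrow> real" and b :: "'i \<Rightarrow> 'i \<Rightarrow> real \<Rightarrow> real"
  assumes I: "finite I" and lr: "l \<le> r"
    and cont: "\<And>i. i \<in> I \<Longrightarrow> continuous_on {l..r} (z i)"
    and bdry: "\<And>i. i \<in> I \<Longrightarrow> 0 \<le> z i l" "\<And>i. i \<in> I \<Longrightarrow> 0 \<le> z i r"
    and z': "\<And>i x. i \<in> I \<Longrightarrow> x \<in> {l<..<r} \<Longrightarrow> (z i has_real_derivative z' i x) (at x)"
    and z'': "\<And>i x. i \<in> I \<Longrightarrow> x \<in> {l<..<r} \<Longrightarrow> (z' i has_real_derivative z'' i x) (at x)"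
    and op: "\<And>i x. i \<in> I \<Longrightarrow> x \<in> {l<..<r} \<Longrightarrow> 0 \<le> - \<epsilon> i * z'' i x + (\<Sum>j\<in>I. b i j x * z j x)"
    and eps: "\<And>i. i \<in> I \<Longrightarrow> 0 < \<epsilon> i"
    and off: "\<And>i j x. i \<in> I \<Longrightarrow> j \<in> I \<Longrightarrow> i \<noteq> j \<Longrightarrow> x \<in> {l<..<r} \<Longrightarrow> b i j x \<le> 0"
    and row: "\<And>i x. i \<in> I \<Longrightarrow> x \<in> {l<..<r} \<Longrightarrow> 0 < (\<Sum>j\<in>I. b i j x)"
    and i: "i \<in> I" and x: "x \<in> {l..r}"
  shows "0 \<le> z i x"
proof (rule ccontr)
  assume neg: "\<not> 0 \<le> z i x"
  have "\<exists>y\<in>{l..r}. \<forall>y'\<in>{l..r}. z j y \<le> z j y'" if "j \<in> I" for j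
    using continuous_attains_inf[of "{l..r}" "z j"] cont[OF that] lr by auto
  then obtain y where y: "\<And>j. j \<in> I \<Longrightarrow> y j \<in> {l..r}"
      "\<And>j y'. j \<in> I \<Longrightarrow> y' \<in> {l..r} \<Longrightarrow> z j (y j) \<le> z j y'"
    by metis
  have ne: "(\<lambda>j. z j (y j)) ` I \<noteq> {}" using i by auto
  obtain k where k: "k \<in> I" "z k (y k) = Min ((\<lambda>j. z j (y j)) ` I)"
    using Min_in[OF finite_imageI[OF I] ne] by (metis (no_types, lifting) imageE)
  have kmin: "z k (y k) \<le> z j t" if "j \<in> I" "t \<in> {l..r}" for j t
    using k(2) Min_le[OF finite_imageI[OF I, of "\<lambda>j. z j (y j)"], of "z j (y j)"] y(2)[OF that] that
    by auto
  have kneg: "z k (y k) < 0" using kmin[OF i x] neg by simp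
  have int: "y k \<in> {l<..<r}"
    using y(1)[OF k(1)] bdry[OF k(1)] kneg by (cases "y k = l"; cases "y k = r") auto
  have "0 \<le> z'' k (y k)"
    by (rule second_derivative_nonneg_at_min[OF int z'[OF k(1)] z''[OF k(1) int]])
       (use kmin[OF k(1)] in auto)
  then have "- \<epsilon> k * z'' k (y k) \<le> 0" using eps[OF k(1)] by simp
  moreover have "(\<Sum>j\<in>I. b k j (y k) * z j (y k)) \<le> (\<Sum>j\<in>I. b k j (y k) * z k (y k))"
  proof (rule sum_mono)
    fix j assume j: "j \<in> I"
    show "b k j (y k) * z j (y k) \<le> b k j (y k) * z k (y k)"
    proof (cases "j = k")
      case False
      then show ?thesis
        using off[OF k(1) j _ int] kmin[OF j, of "y k"] y(1)[OF k(1)]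
        by (intro mult_left_mono_neg) auto
    qed simp
  qed
  moreover have "(\<Sum>j\<in>I. b k j (y k) * z k (y k)) < 0"
    using mult_pos_neg[OF row[OF k(1) int] kneg] by (simp add: sum_distrib_right)
  ultimately show False using op[OF k(1) int] by linarith
qed

lemma system_comparison_principle:
  fixes w w' w'' \<psi> \<psi>' \<psi>'' :: "'i \<Rightarrow> real \<Rightarrow> real" and b :: "'i \<Rightarrow> 'i \<Rightarrow> real \<Rightarrow> real"
  assumes I: "finite I" and lr: "l \<le> r"
    and cont: "\<And>i. i \<in> I \<Longrightarrow> continuous_on {l..r} (w i)"
      "\<And>i. i \<in> I \<Longrightarrow> continuous_on {l..r} (\<psi> i)"
    and bdry: "\<And>i. i \<in> I \<Longrightarrow> \<bar>w i l\<bar> \<le> \<psi> i l" "\<And>i. i \<in> I \<Longrightarrow> \<bar>w i r\<bar> \<le> \<psi> i r"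
    and w': "\<And>i x. i \<in> I \<Longrightarrow> x \<in> {l<..<r} \<Longrightarrow> (w i has_real_derivative w' i x) (at x)"
    and w'': "\<And>i x. i \<in> I \<Longrightarrow> x \<in> {l<..<r} \<Longrightarrow> (w' i has_real_derivative w'' i x) (at x)"
    and \<psi>': "\<And>i x. i \<in> I \<Longrightarrow> x \<in> {l<..<r} \<Longrightarrow> (\<psi> i has_real_derivative \<psi>' i x) (at x)"
    and \<psi>'': "\<And>i x. i \<in> I \<Longrightarrow> x \<in> {l<..<r} \<Longrightarrow> (\<psi>' i has_real_derivative \<psi>'' i x) (at x)"
    and op: "\<And>i x. i \<in> I \<Longrightarrow> x \<in> {l<..<r} \<Longrightarrow>
      \<bar>- \<epsilon> i * w'' i x + (\<Sum>j\<in>I. b i j x * w j x)\<bar> \<le> - \<epsilon> i * \<psi>'' i x + (\<Sum>j\<in>I. b i j x * \<psi> j x)"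
    and eps: "\<And>i. i \<in> I \<Longrightarrow> 0 < \<epsilon> i"
    and off: "\<And>i j x. i \<in> I \<Longrightarrow> j \<in> I \<Longrightarrow> i \<noteq> j \<Longrightarrow> x \<in> {l<..<r} \<Longrightarrow> b i j x \<le> 0"
    and row: "\<And>i x. i \<in> I \<Longrightarrow> x \<in> {l<..<r} \<Longrightarrow> 0 < (\<Sum>j\<in>I. b i j x)"
    and i: "i \<in> I" and x: "x \<in> {l..r}"
  shows "\<bar>w i x\<bar> \<le> \<psi> i x"
proof -
  have *: "0 \<le> \<psi> i x + c * w i x" if c: "\<bar>c\<bar> = 1" for c :: real
  proof (rule system_maximum_principle[where z = "\<lambda>i x. \<psi> i x + c * w i x" and \<epsilon> = \<epsilon>
        and z' = "\<lambda>i x. \<psi>' i x + c * w' i x" and z'' = "\<lambda>i x. \<psi>'' i x + c * w'' i x" and b = b,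
        OF I lr _ _ _ _ _ _ eps off row i x])
    fix j assume j: "j \<in> I"
    show "continuous_on {l..r} (\<lambda>x. \<psi> j x + c * w j x)"
      by (intro continuous_intros cont j)
    have le: "0 \<le> p + c * q" if "\<bar>q\<bar> \<le> p" for p q :: real
      using that c by (auto simp: abs_if split: if_splits)
    show "0 \<le> \<psi> j l + c * w j l" "0 \<le> \<psi> j r + c * w j r"
      using bdry[OF j] by (auto intro: le)
    fix y assume y: "y \<in> {l<..<r}"
    show "((\<lambda>x. \<psi> j x + c * w j x) has_real_derivative \<psi>' j y + c * w' j y) (at y)"
      by (intro DERIV_add DERIV_cmult w' \<psi>' j y)
    show "((\<lambda>x. \<psi>' j x + c * w' j x) has_real_derivative \<psi>'' j y + c * w'' j y) (at y)"
      by (intro DERIV_add DERIV_cmult w'' \<psi>'' j y)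
    have "- \<epsilon> j * (\<psi>'' j y + c * w'' j y) + (\<Sum>k\<in>I. b j k y * (\<psi> k y + c * w k y))
      = (- \<epsilon> j * \<psi>'' j y + (\<Sum>k\<in>I. b j k y * \<psi> k y))
        + c * (- \<epsilon> j * w'' j y + (\<Sum>k\<in>I. b j k y * w k y))"
      by (simp add: algebra_simps sum.distrib sum_distrib_left)
    then show "0 \<le> - \<epsilon> j * (\<psi>'' j y + c * w'' j y) + (\<Sum>k\<in>I. b j k y * (\<psi> k y + c * w k y))"
      using le[OF op[OF j y]] by simp
  qed auto
  show ?thesis using *[of 1] *[of "-1"] by simp
qed

text \<open>At a smallest mesh value the forward difference is nonnegative and the backward one
  nonpositive, whatever the two step lengths are. So \<open>delta2\<close> has the right sign on
  every mesh and the continuous argument carries over.\<close>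

lemma discrete_maximum_principle:
  fixes z :: "'i \<Rightarrow> nat \<Rightarrow> real" and b :: "'i \<Rightarrow> 'i \<Rightarrow> nat \<Rightarrow> real"
  assumes I: "finite I"
    and mesh: "\<And>j. j < N \<Longrightarrow> x j < x (Suc j)"
    and bdry: "\<And>i. i \<in> I \<Longrightarrow> 0 \<le> z i 0" "\<And>i. i \<in> I \<Longrightarrow> 0 \<le> z i N"
    and op: "\<And>i j. i \<in> I \<Longrightarrow> j \<in> {1..N - 1} \<Longrightarrow>
      0 \<le> - \<epsilon> i * delta2 x (z i) j + (\<Sum>k\<in>I. b i k j * z k j)"
    and eps: "\<And>i. i \<in> I \<Longrightarrow> 0 < \<epsilon> i"
    and off: "\<And>i k j. i \<in> I \<Longrightarrow> k \<in> I \<Longrightarrow> i \<noteq> k \<Longrightarrow> j \<in> {1..N - 1} \<Longrightarrow> b i k j \<le> 0"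
    and row: "\<And>i j. i \<in> I \<Longrightarrow> j \<in> {1..N - 1} \<Longrightarrow> 0 < (\<Sum>k\<in>I. b i k j)"
    and i: "i \<in> I" and j: "j \<le> N"
  shows "0 \<le> z i j"
proof (rule ccontr)
  assume neg: "\<not> 0 \<le> z i j"
  define P where "P = I \<times> {..N}"
  have P: "finite P" "P \<noteq> {}" using I i by (auto simp: P_def)
  obtain p where p: "p \<in> P" "(\<lambda>(i, j). z i j) p = Min ((\<lambda>(i, j). z i j) ` P)"
    using Min_in[of "(\<lambda>(i, j). z i j) ` P"] P by (metis (no_types, lifting) finite_imageI imageE image_is_empty)
  obtain k m where km: "p = (k, m)" by (cases p)
  have k: "k \<in> I" "m \<le> N" using p(1) km by (auto simp: P_def)
  have kmin: "z k m \<le> z i' j'" if "i' \<in> I" "j' \<le> N" for i' j'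
  proof -
    have "(i', j') \<in> P" using that by (simp add: P_def)
    then have "z i' j' \<in> (\<lambda>(i, j). z i j) ` P" by force
    then show ?thesis using p(2) km P(1) by auto
  qed
  have kneg: "z k m < 0" using kmin[OF i j] neg by simp
  have m: "m \<in> {1..N - 1}"
    using k(2) bdry[OF k(1)] kneg by (cases "m = 0"; cases "m = N") auto
  have h: "0 < x (m + 1) - x m" "0 < x m - x (m - 1)"
    using m mesh[of m] mesh[of "m - 1"] by auto
  have "0 \<le> Dplus x (z k) m"
    using h kmin[OF k(1), of "m + 1"] m by (auto simp: Dplus_def)
  moreover have "Dminus x (z k) m \<le> 0"
    using h kmin[OF k(1), of "m - 1"] m by (auto simp: Dminus_def divide_nonpos_pos)
  ultimately have "0 \<le> delta2 x (z k) m"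
    using h by (simp add: delta2_def)
  then have "- \<epsilon> k * delta2 x (z k) m \<le> 0" using eps[OF k(1)] by simp
  moreover have "(\<Sum>l\<in>I. b k l m * z l m) \<le> (\<Sum>l\<in>I. b k l m * z k m)"
  proof (rule sum_mono)
    fix l assume l: "l \<in> I"
    show "b k l m * z l m \<le> b k l m * z k m"
    proof (cases "l = k")
      case False
      then show ?thesis
        using off[OF k(1) l _ m] kmin[OF l k(2)] by (intro mult_left_mono_neg) auto
    qed simp
  qed
  moreover have "(\<Sum>l\<in>I. b k l m * z k m) < 0"
    using mult_pos_neg[OF row[OF k(1) m] kneg] by (simp add: sum_distrib_right)
  ultimately show False using op[OF k(1) m] by linarith
qed

lemma delta2_affine: "delta2 x (\<lambda>j. p + c * V j) j = c * delta2 x V j"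
proof -
  have "Dplus x (\<lambda>j. p + c * V j) j = c * Dplus x V j"
    "Dminus x (\<lambda>j. p + c * V j) j = c * Dminus x V j"
    by (simp_all add: Dplus_def Dminus_def algebra_simps diff_divide_distrib)
  then show ?thesis by (simp add: delta2_def algebra_simps diff_divide_distrib)
qed

lemma delta2_diff: "delta2 x (\<lambda>j. V j - W j) j = delta2 x V j - delta2 x W j"
proof -
  have "Dplus x (\<lambda>j. V j - W j) j = Dplus x V j - Dplus x W j"
    "Dminus x (\<lambda>j. V j - W j) j = Dminus x V j - Dminus x W j"
    by (simp_all add: Dplus_def Dminus_def algebra_simps flip: diff_divide_distrib)
  then show ?thesis by (simp add: delta2_def algebra_simps flip: diff_divide_distrib)
qed

text \<open>The constant \<open>\<delta> / \<alpha>\<close> is a barrier: its second differences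
  vanish, and row sums above \<open>\<alpha>\<close> raise it to at least \<open>\<delta>\<close>.
  Hence the stability constant depends neither on the mesh nor on \<open>\<epsilon>\<close>.\<close>

lemma discrete_stability:
  fixes V :: "'i \<Rightarrow> nat \<Rightarrow> real" and b :: "'i \<Rightarrow> 'i \<Rightarrow> nat \<Rightarrow> real"
  assumes I: "finite I"
    and mesh: "\<And>j. j < N \<Longrightarrow> x j < x (Suc j)"
    and bdry: "\<And>i. i \<in> I \<Longrightarrow> V i 0 = 0" "\<And>i. i \<in> I \<Longrightarrow> V i N = 0"
    and op: "\<And>i j. i \<in> I \<Longrightarrow> j \<in> {1..N - 1} \<Longrightarrow>
      \<bar>- \<epsilon> i * delta2 x (V i) j + (\<Sum>k\<in>I. b i k j * V k j)\<bar> \<le> \<delta>"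
    and eps: "\<And>i. i \<in> I \<Longrightarrow> 0 < \<epsilon> i"
    and off: "\<And>i k j. i \<in> I \<Longrightarrow> k \<in> I \<Longrightarrow> i \<noteq> k \<Longrightarrow> j \<in> {1..N - 1} \<Longrightarrow> b i k j \<le> 0"
    and row: "\<And>i j. i \<in> I \<Longrightarrow> j \<in> {1..N - 1} \<Longrightarrow> \<alpha> < (\<Sum>k\<in>I. b i k j)"
    and \<alpha>: "0 < \<alpha>" and \<delta>: "0 \<le> \<delta>" and i: "i \<in> I" and j: "j \<le> N"
  shows "\<bar>V i j\<bar> \<le> \<delta> / \<alpha>"
proof -
  have *: "0 \<le> \<delta> / \<alpha> + c * V i j" if c: "\<bar>c\<bar> = 1" for c :: real
  proof (rule discrete_maximum_principle[where z = "\<lambda>i j. \<delta> / \<alpha> + c * V i j" and b = b and \<epsilon> = \<epsilon>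
        and x = x and N = N,
        OF I mesh _ _ _ eps off _ i j])
    fix k assume k: "k \<in> I"
    show "0 \<le> \<delta> / \<alpha> + c * V k 0" "0 \<le> \<delta> / \<alpha> + c * V k N"
      using bdry[OF k] \<alpha> \<delta> by auto
    fix m assume m: "m \<in> {1..N - 1}"
    show "0 < (\<Sum>l\<in>I. b k l m)" using row[OF k m] \<alpha> by simp
    have "- \<epsilon> k * delta2 x (\<lambda>j. \<delta> / \<alpha> + c * V k j) m + (\<Sum>l\<in>I. b k l m * (\<delta> / \<alpha> + c * V l m))
       = (\<Sum>l\<in>I. b k l m) * (\<delta> / \<alpha>) + c * (- \<epsilon> k * delta2 x (V k) m + (\<Sum>l\<in>I. b k l m * V l m))"
      unfolding delta2_affine
      by (simp add: algebra_simps sum.distrib sum_distrib_left sum_distrib_right)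
    moreover have "\<alpha> * (\<delta> / \<alpha>) \<le> (\<Sum>l\<in>I. b k l m) * (\<delta> / \<alpha>)"
      using row[OF k m] \<alpha> \<delta> by (intro mult_right_mono) auto
    ultimately show "0 \<le> - \<epsilon> k * delta2 x (\<lambda>j. \<delta> / \<alpha> + c * V k j) m
        + (\<Sum>l\<in>I. b k l m * (\<delta> / \<alpha> + c * V l m))"
      using op[OF k m] c \<alpha> by (auto simp: abs_if split: if_splits)
  qed auto
  show ?thesis using *[of 1] *[of "-1"] by simp
qed

section \<open>Mean value estimates\<close>

text \<open>Some point has the mean slope of the whole interval, at most \<open>2 * B / s\<close> in
  size, and the bound on the second derivative carries this to every other point. With
  \<open>s = sqrt (\<epsilon> i)\<close> the quantity \<open>D\<close> becomes a bound for
  \<open>\<epsilon> i * u'' i\<close>, which the equation supplies without negative powers of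
  \<open>\<epsilon> i\<close>.\<close>

lemma slope_bound:
  fixes g g' g'' :: "real \<Rightarrow> real"
  assumes s: "0 < s"
    and cont: "continuous_on {c..c + s} g"
    and g': "\<And>x. x \<in> {c<..<c + s} \<Longrightarrow> (g has_real_derivative g' x) (at x)"
    and g'': "\<And>x. x \<in> {c<..<c + s} \<Longrightarrow> (g' has_real_derivative g'' x) (at x)"
    and B: "\<And>x. x \<in> {c..c + s} \<Longrightarrow> \<bar>g x\<bar> \<le> B"
    and D: "\<And>x. x \<in> {c<..<c + s} \<Longrightarrow> s\<^sup>2 * \<bar>g'' x\<bar> \<le> D"
    and xy: "c \<le> x" "x \<le> y" "y \<le> c + s"
  shows "\<bar>g y - g x\<bar> \<le> (2 * B + D) * ((y - x) / s)"
proof (cases "x = y")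
  case False
  then have "x < y" using xy by simp
  have mvt: "\<exists>z>p. z < q \<and> g q - g p = (q - p) * g' z"
    if pq: "c \<le> p" "p < q" "q \<le> c + s" for p q
  proof -
    have "continuous_on {p..q} g"
      by (rule continuous_on_subset[OF cont]) (use pq in auto)
    then obtain l z where z: "p < z" "z < q" "(g has_real_derivative l) (at z)" "g q - g p = (q - p) * l"
      using MVT[OF pq(2), of g] g' pq
      by (metis greaterThanLessThan_iff le_less_trans less_le_trans real_differentiable_def)
    have "(g has_real_derivative g' z) (at z)" using g'[of z] z pq by auto
    then have "l = g' z" using z(3) DERIV_unique by blast
    with z show ?thesis by blast
  qed
  have g'bound: "\<bar>g' z\<bar> \<le> (2 * B + D) / s" if z: "z \<in> {c<..<c + s}" for z
  proof -
    obtain t where t: "c < t" "t < c + s" "g (c + s) - g c = s * g' t"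
      using mvt[of c "c + s"] s by auto
    have "s * \<bar>g' t\<bar> = \<bar>g (c + s) - g c\<bar>" using t(3) s by (simp add: abs_mult)
    also have "\<dots> \<le> 2 * B" using B[of c] B[of "c + s"] s by auto
    finally have gt: "s * \<bar>g' t\<bar> \<le> 2 * B" .
    have "\<exists>v\<in>{c<..<c + s}. \<bar>g' z - g' t\<bar> \<le> s * \<bar>g'' v\<bar>"
    proof (cases z t rule: linorder_cases)
      case less
      obtain v where v: "z < v" "v < t" "g' t - g' z = (t - z) * g'' v"
        using MVT2[OF less, of g' g''] g'' z t by auto
      have "\<bar>g' z - g' t\<bar> = (t - z) * \<bar>g'' v\<bar>" using v less by (metis abs_minus_commute abs_mult abs_of_pos diff_gt_0_iff_gt)
      also have "\<dots> \<le> s * \<bar>g'' v\<bar>" using z t by (intro mult_right_mono) auto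
      finally show ?thesis using v z t by auto
    next
      case equal
      then show ?thesis using z s by auto
    next
      case greater
      obtain v where v: "t < v" "v < z" "g' z - g' t = (z - t) * g'' v"
        using MVT2[OF greater, of g' g''] g'' z t by auto
      have "\<bar>g' z - g' t\<bar> = (z - t) * \<bar>g'' v\<bar>" using v greater by (simp add: abs_mult)
      also have "\<dots> \<le> s * \<bar>g'' v\<bar>" using z t by (intro mult_right_mono) auto
      finally show ?thesis using v z t by auto
    qed
    then obtain v where v: "v \<in> {c<..<c + s}" "\<bar>g' z - g' t\<bar> \<le> s * \<bar>g'' v\<bar>" by blast
    have "s * \<bar>g' z\<bar> \<le> s * (\<bar>g' t\<bar> + s * \<bar>g'' v\<bar>)"
      using v(2) s by (intro mult_left_mono) auto
    also have "\<dots> \<le> 2 * B + D" using gt D[OF v(1)] by (simp add: algebra_simps power2_eq_square)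
    finally show ?thesis using s by (simp add: field_simps)
  qed
  obtain z where z: "x < z" "z < y" "g y - g x = (y - x) * g' z"
    using mvt[OF xy(1) \<open>x < y\<close> xy(3)] by blast
  have "\<bar>g y - g x\<bar> = (y - x) * \<bar>g' z\<bar>" using z(3) xy by (simp add: abs_mult)
  also have "\<dots> \<le> (y - x) * ((2 * B + D) / s)"
    using g'bound[of z] z xy by (intro mult_left_mono) auto
  finally show ?thesis by (simp add: mult.commute)
qed simp

lemma second_difference_mean_value:
  fixes g g' g'' :: "real \<Rightarrow> real"
  assumes x: "x (j - 1) < x j" "x j < x (j + 1)"
    and cont: "continuous_on {x (j - 1)..x (j + 1)} g"
    and g': "\<And>t. t \<in> {x (j - 1)<..<x (j + 1)} \<Longrightarrow> (g has_real_derivative g' t) (at t)"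
    and g'': "\<And>t. t \<in> {x (j - 1)<..<x (j + 1)} \<Longrightarrow> (g' has_real_derivative g'' t) (at t)"
  obtains \<xi> where "x (j - 1) < \<xi>" "\<xi> < x (j + 1)" "delta2 x (\<lambda>k. g (x k)) j = g'' \<xi>"
proof -
  define p q r where "p = x (j - 1)" and "q = x j" and "r = x (j + 1)"
  define A where "A = (g q - g p) / (q - p)"
  define B where "B = (g r - g q) / (r - q)"
  define d where "d = delta2 x (\<lambda>k. g (x k)) j"
  have pqr: "p < q" "q < r" using x by (auto simp: p_def q_def r_def)
  have d: "d * (r - p) = 2 * (B - A)"
  proof -
    have "d = (B - A) / ((q - p + (r - q)) / 2)"
      by (simp add: d_def delta2_def Dplus_def Dminus_def p_def q_def r_def A_def B_def)
    then show ?thesis using pqr by (simp add: field_simps)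
  qed
  \<comment> \<open>Up to the constant \<open>g p\<close>, this is \<open>g\<close> minus its Newton
    interpolant at \<open>p\<close>, \<open>q\<close>, \<open>r\<close>, with \<open>d / 2\<close>
    the second divided difference. Its values at the three nodes agree, so Rolle applies on both
    sides of \<open>q\<close>.\<close>
  define F where "F t = g t - A * (t - p) - d / 2 * (t - p) * (t - q)" for t
  define F' where "F' t = g' t - A - d / 2 * ((t - p) + (t - q))" for t
  have F': "(F has_real_derivative F' t) (at t)" if "p < t" "t < r" for t
  proof -
    have "(g has_real_derivative g' t) (at t)" using g' that by (simp add: p_def r_def)
    then show ?thesis unfolding F_def F'_def
      by (auto intro!: derivative_eq_intros simp: field_simps)
  qed
  then have dF: "F differentiable (at t)" if "p < t" "t < r" for t
    using that unfolding real_differentiable_def by blast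
  have F'': "(F' has_real_derivative g'' t - d) (at t)" if "p < t" "t < r" for t
  proof -
    have "(g' has_real_derivative g'' t) (at t)" using g'' that by (simp add: p_def r_def)
    then show ?thesis unfolding F'_def
      by (auto intro!: derivative_eq_intros simp: field_simps)
  qed
  have cF: "continuous_on {p..r} F"
    unfolding F_def by (intro continuous_intros cont[folded p_def r_def])
  have Fpq: "F p = F q" using pqr by (simp add: F_def A_def)
  have "A * (q - p) = g q - g p" "B * (r - q) = g r - g q" using pqr by (auto simp: A_def B_def)
  moreover have "d / 2 * (r - p) * (r - q) = (B - A) * (r - q)"
    using d by simp
  ultimately have Fqr: "F q = F r" by (simp add: F_def algebra_simps)
  obtain s where s: "p < s" "s < q" "F' s = 0"
  proof -
    have "\<exists>z>p. z < q \<and> (F has_real_derivative 0) (at z)"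
      by (rule Rolle[OF pqr(1) Fpq])
         (use cF pqr dF in \<open>auto intro: continuous_on_subset\<close>)
    then show ?thesis using that F' pqr by (metis DERIV_unique less_trans)
  qed
  obtain t where t: "q < t" "t < r" "F' t = 0"
  proof -
    have "\<exists>z>q. z < r \<and> (F has_real_derivative 0) (at z)"
      by (rule Rolle[OF pqr(2) Fqr])
         (use cF pqr dF in \<open>auto intro: continuous_on_subset\<close>)
    then show ?thesis using that F' pqr by (metis DERIV_unique less_trans)
  qed
  have "s < t" using s t by simp
  then obtain v where v: "s < v" "v < t" "F' t - F' s = (t - s) * (g'' v - d)"
    using MVT2[of s t F' "\<lambda>t. g'' t - d"] F'' s t pqr by force
  have "g'' v = d" using v s t by auto
  then show ?thesis using that[of v] v s t by (simp add: p_def r_def d_def)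
qed

section \<open>A barrier for all scales\<close>

text \<open>Climb from \<open>i\<close> as long as the next scale is at most \<open>R\<close> times
  the current one. The climb stops at \<open>q\<close>, and each of its at most \<open>n - i\<close>
  steps costs a factor \<open>R\<close>.\<close>

lemma scale_cluster_top:
  fixes \<epsilon> :: "nat \<Rightarrow> real"
  assumes R: "1 \<le> R" and pos: "\<And>i. i \<in> {1..n} \<Longrightarrow> 0 < \<epsilon> i" and i: "i \<in> {1..n}"
  shows "\<exists>q\<in>{i..n}. (q = n \<or> R * \<epsilon> q < \<epsilon> (Suc q)) \<and> \<epsilon> q \<le> R ^ (n - i) * \<epsilon> i"
proof -
  have "i \<le> n" "1 \<le> i" using i by auto
  then show ?thesis
  proof (induction i rule: inc_induct)
    case base
    then show ?case by auto
  next
    case (step m)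
    show ?case
    proof (cases "R * \<epsilon> m < \<epsilon> (Suc m)")
      case True
      have "1 * \<epsilon> m \<le> R ^ (n - m) * \<epsilon> m"
        using R pos[of m] step by (intro mult_right_mono one_le_power) auto
      then show ?thesis using True step by auto
    next
      case False
      obtain q where q: "q \<in> {Suc m..n}" "q = n \<or> R * \<epsilon> q < \<epsilon> (Suc q)"
          "\<epsilon> q \<le> R ^ (n - Suc m) * \<epsilon> (Suc m)"
        using step.IH step.hyps step.prems by fastforce
      note q(3)
      also have "R ^ (n - Suc m) * \<epsilon> (Suc m) \<le> R ^ (n - Suc m) * (R * \<epsilon> m)"
        using False R by (intro mult_left_mono) auto
      also have "\<dots> = R ^ (n - m) * \<epsilon> m"
        using step by (simp add: Suc_diff_Suc flip: power_Suc2 mult.assoc)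
      finally show ?thesis using q by (intro bexI[of _ q]) auto
    qed
  qed
qed

text \<open>The barrier for component \<open>i\<close> is \<open>\<Sum>p. M i p * exp (- sqrt (\<alpha> / \<epsilon> p) * x)\<close>. The layer of
  scale \<open>\<epsilon> p\<close> enters the slower components \<open>i > p\<close> with a negative coefficient of order
  \<open>\<epsilon> p / \<epsilon> i\<close>, which is possible only if \<open>\<epsilon> i / \<epsilon> p\<close> is not close to \<open>1\<close>. So scales with bounded
  consecutive ratios are lumped together, and only the largest scale of each cluster is used.\<close>

lemma barrier_coefficients:
  fixes \<epsilon> :: "nat \<Rightarrow> real" and \<alpha> H h C :: real
  defines "R \<equiv> 2 * H / \<alpha>" and "m \<equiv> \<lambda>i. min 1 (h / sqrt (\<epsilon> i))"
  assumes \<alpha>: "0 < \<alpha>" "\<alpha> \<le> H" and h: "0 \<le> h" and C: "0 \<le> C"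
    and pos: "\<And>i. i \<in> {1..n} \<Longrightarrow> 0 < \<epsilon> i" and mono: "strict_mono_on {1..n} \<epsilon>"
  obtains M :: "nat \<Rightarrow> nat \<Rightarrow> real" where
    "\<And>i p b. \<lbrakk>i \<in> {1..n}; p \<in> {1..n}; \<And>j. j \<in> {1..n} \<Longrightarrow> j \<noteq> i \<Longrightarrow> b j \<le> 0;
      \<alpha> \<le> (\<Sum>j\<in>{1..n}. b j); b i \<le> H\<rbrakk>
      \<Longrightarrow> \<alpha> * (\<epsilon> i / \<epsilon> p) * M i p \<le> (\<Sum>j\<in>{1..n}. b j * M j p)"
    "\<And>i e. \<lbrakk>i \<in> {1..n}; \<And>p. p \<in> {1..n} \<Longrightarrow> 0 \<le> e p;
      \<And>p q. p \<in> {1..n} \<Longrightarrow> q \<in> {1..n} \<Longrightarrow> p \<le> q \<Longrightarrow> e p \<le> e q\<rbrakk>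
      \<Longrightarrow> C * m i * e i \<le> (\<Sum>p\<in>{1..n}. M i p * e p)"
    "\<And>i p. i \<in> {1..n} \<Longrightarrow> p \<in> {1..n} \<Longrightarrow> M i p \<le> C * (1 + R ^ Suc n) ^ n * m p"
proof -
  have R: "1 \<le> R" "0 \<le> R" using \<alpha> by (auto simp: R_def field_simps)
  define G where "G = R ^ Suc n"
  have G: "1 \<le> G" using R by (simp add: G_def one_le_power del: power_Suc)
  \<comment> \<open>The solution of the recursion \<open>Ksum\<close>. The top scale
    \<open>q\<close> of a cluster has to outweigh the losses from all faster scales
    \<open>p < q\<close>, each proportional to \<open>G * K p\<close>; hence the geometric growth.
    \<open>G\<close> collects the factor \<open>R\<close> in \<open>M\<close> and the factor
    \<open>R ^ n\<close> from comparing scales within a cluster.\<close>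
  define K where "K p = C * (1 + G) ^ p" for p :: nat
  have K: "0 \<le> K p" for p using C G by (simp add: K_def)
  have Ksum: "K q = C + G * (\<Sum>p<q. K p)" for q
  proof (induction q)
    case (Suc q)
    have "K (Suc q) = K q + G * K q" by (simp add: K_def algebra_simps)
    then show ?case using Suc by (simp add: distrib_left)
  qed (simp add: K_def)
  have m0: "0 \<le> m p" if "p \<in> {1..n}" for p using h pos[OF that] by (simp add: m_def)
  have le: "\<epsilon> p \<le> \<epsilon> q" if "p \<in> {1..n}" "q \<in> {1..n}" "p \<le> q" for p q
    using strict_mono_onD[OF mono that(1,2)] that(3) by (cases "p = q") auto
  define T where "T = {p \<in> {1..n}. p = n \<or> R * \<epsilon> p < \<epsilon> (Suc p)}"
  \<comment> \<open>For \<open>i > p\<close> the diffusion term contributes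
    \<open>- \<alpha> * (\<epsilon> i / \<epsilon> p) * M i p\<close>, which has no lower bound if
    the coefficient is a fixed positive number. The factor
    \<open>\<epsilon> p / \<epsilon> i\<close> with a minus sign turns it into the gain
    \<open>2 * H * K p * m p\<close>, whatever the ratio is.\<close>
  define M where "M i p = (if p \<notin> T then 0 else if i \<le> p then K p * m p
    else - (R * K p * m p * (\<epsilon> p / \<epsilon> i)))" for i p
  have Mle: "M i p \<le> K p * m p" if "i \<in> {1..n}" "p \<in> {1..n}" for i p
  proof -
    have "0 \<le> K p * m p" using K m0[OF that(2)] by simp
    moreover have "0 \<le> R * K p * m p * (\<epsilon> p / \<epsilon> i)"
      using K m0[OF that(2)] R pos[OF that(1)] pos[OF that(2)] by simp
    ultimately show ?thesis by (auto simp: M_def)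
  qed
  show ?thesis
  proof (rule that)
    fix i p :: nat and b :: "nat \<Rightarrow> real"
    assume i: "i \<in> {1..n}" and p: "p \<in> {1..n}"
      and off: "\<And>j. j \<in> {1..n} \<Longrightarrow> j \<noteq> i \<Longrightarrow> b j \<le> 0"
      and row: "\<alpha> \<le> (\<Sum>j\<in>{1..n}. b j)" and bH: "b i \<le> H"
    define \<kappa> where "\<kappa> = K p * m p"
    have \<kappa>: "0 \<le> \<kappa>" using K m0[OF p] by (simp add: \<kappa>_def)
    have split: "(\<Sum>j\<in>{1..n}. c j) = c i + (\<Sum>j\<in>{1..n} - {i}. c j)" for c :: "nat \<Rightarrow> real"
      using i by (simp add: sum.remove)
    have rest: "(\<Sum>j\<in>{1..n} - {i}. b j) * \<kappa> \<le> (\<Sum>j\<in>{1..n} - {i}. b j * M j p)"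
      unfolding sum_distrib_right
      by (intro sum_mono mult_left_mono_neg) (use off Mle p in \<open>auto simp: \<kappa>_def\<close>)
    consider "p \<notin> T" | "p \<in> T" "i \<le> p" | "p \<in> T" "p < i" by linarith
    then show "\<alpha> * (\<epsilon> i / \<epsilon> p) * M i p \<le> (\<Sum>j\<in>{1..n}. b j * M j p)"
    proof cases
      case 1
      then show ?thesis by (simp add: M_def)
    next
      case 2
      have "\<epsilon> i / \<epsilon> p \<le> 1" using le[OF i p 2(2)] pos[OF p] by simp
      then have "\<alpha> * (\<epsilon> i / \<epsilon> p) * M i p \<le> \<alpha> * 1 * \<kappa>"
        using 2 \<kappa> \<alpha> unfolding M_def \<kappa>_def[symmetric]
        by (simp del: times_divide_eq_right times_divide_eq_left mult.assoc add: mult_right_mono mult_left_le)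
      also have "\<dots> \<le> (\<Sum>j\<in>{1..n}. b j) * \<kappa>" using row \<kappa> by (simp add: mult_right_mono)
      also have "\<dots> \<le> (\<Sum>j\<in>{1..n}. b j * M j p)"
      proof -
        have "M i p = \<kappa>" using 2 by (simp add: M_def \<kappa>_def)
        then show ?thesis
          using rest unfolding split[of b] split[of "\<lambda>j. b j * M j p"] by (simp add: distrib_right)
      qed
      finally show ?thesis .
    next
      case 3
      have "R * \<epsilon> p < \<epsilon> (Suc p)" using 3 i by (auto simp: T_def)
      also have "\<epsilon> (Suc p) \<le> \<epsilon> i" by (rule le) (use 3 i p in auto)
      finally have gap: "R * (\<epsilon> p / \<epsilon> i) \<le> 1" using pos[OF i] by simp
      have Mi: "M i p = - (R * (\<epsilon> p / \<epsilon> i) * \<kappa>)" using 3 by (simp add: M_def \<kappa>_def)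
      \<comment> \<open>\<open>R = 2 * H / \<alpha>\<close> is chosen for this value. One
        \<open>H * \<kappa>\<close> pays for the off-diagonal entries, which sum to at least
        \<open>- b i\<close>; the other pays for the diagonal entry times the negative coefficient,
        whose size is at most \<open>\<kappa>\<close> by \<open>gap\<close>.\<close>
      have "\<alpha> * (\<epsilon> i / \<epsilon> p) * M i p = - (2 * H * \<kappa>)"
        using pos[OF i] pos[OF p] \<alpha> by (simp add: Mi R_def)
      also have "\<dots> \<le> b i * M i p - b i * \<kappa>"
      proof -
        have nn: "(\<Sum>j\<in>{1..n} - {i}. b j) \<le> 0" using off by (intro sum_nonpos) auto
        have bi: "0 \<le> b i" using row \<alpha> nn unfolding split[of b] by linarith
        have "b i * (R * (\<epsilon> p / \<epsilon> i)) \<le> H * 1"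
          using bi bH gap R pos[OF i] pos[OF p] by (intro mult_mono) auto
        from mult_right_mono[OF this \<kappa>] mult_right_mono[OF bH \<kappa>]
        have "b i * (R * (\<epsilon> p / \<epsilon> i)) * \<kappa> \<le> H * \<kappa>" "b i * \<kappa> \<le> H * \<kappa>"
          by simp_all
        then show ?thesis unfolding Mi by (simp add: algebra_simps)
      qed
      also have "- (b i * \<kappa>) \<le> (\<Sum>j\<in>{1..n} - {i}. b j) * \<kappa>"
      proof -
        have "0 \<le> (\<Sum>j\<in>{1..n}. b j) * \<kappa>" using row \<alpha> \<kappa> by simp
        then show ?thesis unfolding split[of b] by (simp add: distrib_right)
      qed
      then have "b i * M i p - b i * \<kappa> \<le> b i * M i p + (\<Sum>j\<in>{1..n} - {i}. b j * M j p)"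
        using rest by linarith
      also have "\<dots> = (\<Sum>j\<in>{1..n}. b j * M j p)"
        by (rule split[of "\<lambda>j. b j * M j p", symmetric])
      finally show ?thesis .
    qed
  next
    fix i :: nat and e :: "nat \<Rightarrow> real"
    assume i: "i \<in> {1..n}" and e0: "\<And>p. p \<in> {1..n} \<Longrightarrow> 0 \<le> e p"
      and emono: "\<And>p q. p \<in> {1..n} \<Longrightarrow> q \<in> {1..n} \<Longrightarrow> p \<le> q \<Longrightarrow> e p \<le> e q"
    obtain q where q: "q \<in> {i..n}" "q = n \<or> R * \<epsilon> q < \<epsilon> (Suc q)" "\<epsilon> q \<le> R ^ (n - i) * \<epsilon> i"
      using scale_cluster_top[of R n \<epsilon> i, OF R(1) pos i] by blast
    have qn: "q \<in> {1..n}" and qT: "q \<in> T" using q i by (auto simp: T_def)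
    have Rn: "R ^ (n - i) \<le> R ^ n" "1 \<le> R ^ n" using R by (auto intro: power_increasing one_le_power)
    \<comment> \<open>Scale \<open>i\<close> itself has a barrier term only if \<open>i\<close> lies
      in \<open>T\<close>. In general the top \<open>q\<close> of its cluster takes over, at the
      cost of a power of \<open>R\<close>.\<close>
    have miq: "m i \<le> R ^ n * m q"
    proof -
      have "\<epsilon> q \<le> (R ^ n)\<^sup>2 * \<epsilon> i"
      proof -
        note q(3)
        also have "R ^ (n - i) * \<epsilon> i \<le> R ^ n * \<epsilon> i" using Rn pos[OF i] by (intro mult_right_mono) auto
        also have "\<dots> \<le> (R ^ n)\<^sup>2 * \<epsilon> i"
          using Rn pos[OF i] by (intro mult_right_mono) (auto simp: power2_eq_square)
        finally show ?thesis .
      qed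
      then have "sqrt (\<epsilon> q) \<le> R ^ n * sqrt (\<epsilon> i)"
        using real_sqrt_le_mono[of "\<epsilon> q" "(R ^ n)\<^sup>2 * \<epsilon> i"] R(2) by (simp add: real_sqrt_mult)
      then have "h * sqrt (\<epsilon> q) \<le> h * (R ^ n * sqrt (\<epsilon> i))" using h by (rule mult_left_mono)
      then have "h / sqrt (\<epsilon> i) \<le> R ^ n * (h / sqrt (\<epsilon> q))"
        using pos[OF i] pos[OF qn] by (simp add: field_simps)
      moreover have "m i \<le> R ^ n * 1" using Rn by (simp add: m_def)
      ultimately show ?thesis by (auto simp: m_def min_def)
    qed
    \<comment> \<open>A faster scale may have weight \<open>m p = 1\<close> while \<open>m i\<close>
      is tiny. The damping factor in \<open>M\<close> repairs this, since
      \<open>sqrt (\<epsilon> p) / \<epsilon> i\<close> is at most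
      \<open>1 / sqrt (\<epsilon> i)\<close>.\<close>
    have small: "m p * (\<epsilon> p / \<epsilon> i) \<le> m i" if p: "p \<in> {1..n}" "p \<le> i" for p
    proof -
      have r: "0 \<le> \<epsilon> p / \<epsilon> i" "\<epsilon> p / \<epsilon> i \<le> 1" using le[OF p(1) i p(2)] pos[OF i] pos[OF p(1)] by auto
      have "m p * (\<epsilon> p / \<epsilon> i) \<le> 1 * 1" using r m0[OF p(1)] by (intro mult_mono) (auto simp: m_def)
      moreover have "m p * (\<epsilon> p / \<epsilon> i) \<le> h / sqrt (\<epsilon> i)"
      proof -
        have "m p * (\<epsilon> p / \<epsilon> i) \<le> h / sqrt (\<epsilon> p) * (\<epsilon> p / \<epsilon> i)"
          using r by (intro mult_right_mono) (auto simp: m_def)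
        also have "\<dots> = h * (sqrt (\<epsilon> p) / \<epsilon> i)"
        proof -
          have "h / sqrt (\<epsilon> p) * (\<epsilon> p / \<epsilon> i) = h * (\<epsilon> p / sqrt (\<epsilon> p) / \<epsilon> i)" by simp
          then show ?thesis using pos[OF p(1)] by (simp only: real_div_sqrt less_imp_le)
        qed
        also have "\<dots> \<le> h * (sqrt (\<epsilon> i) / \<epsilon> i)"
          using h le[OF p(1) i p(2)] pos[OF i] by (intro mult_left_mono divide_right_mono) auto
        also have "\<dots> = h / sqrt (\<epsilon> i)"
        proof -
          have "h * (sqrt (\<epsilon> i) / \<epsilon> i) = h * inverse (sqrt (\<epsilon> i))"
            using pos[OF i] by (simp only: sqrt_divide_self_eq less_imp_le)
          then show ?thesis by (simp add: divide_inverse)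
        qed
        finally show ?thesis .
      qed
      ultimately show ?thesis by (simp add: m_def)
    qed
    define \<mu> where "\<mu> = m q * e q"
    have \<mu>: "0 \<le> \<mu>" using m0[OF qn] e0[OF qn] by (simp add: \<mu>_def)
    \<comment> \<open>Only cluster tops \<open>p < i\<close> have negative coefficients, and
      \<open>i \<le> q\<close>; so all losses come from indices below \<open>q\<close>.\<close>
    have term_ge: "- (if p < q then G * K p * \<mu> else 0) \<le> M i p * e p" if p: "p \<in> {1..n} - {q}" for p
    proof (cases "p \<in> T \<and> p < i")
      case True
      have pn: "p \<in> {1..n}" using p by simp
      have "m p * (\<epsilon> p / \<epsilon> i) \<le> R ^ n * m q"
        using small[OF pn] miq True by simp
      then have "m p * (\<epsilon> p / \<epsilon> i) * e p \<le> R ^ n * m q * e q"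
        by (rule mult_mono) (use R m0[OF qn] emono[OF pn qn] e0[OF pn] True q in auto)
      then have "R * K p * (m p * (\<epsilon> p / \<epsilon> i) * e p) \<le> R * K p * (R ^ n * m q * e q)"
        using R K[of p] by (intro mult_left_mono) auto
      also have "\<dots> = G * K p * \<mu>" by (simp add: G_def \<mu>_def)
      finally show ?thesis using True q(1) by (simp add: M_def algebra_simps)
    next
      case False
      have "0 \<le> M i p * e p"
        using False p K m0 e0 by (auto simp: M_def)
      moreover have "0 \<le> (if p < q then G * K p * \<mu> else 0)" using G K[of p] \<mu> by auto
      ultimately show ?thesis by linarith
    qed
    have "C * m i * e i \<le> C * (G * \<mu>)"
    proof -
      have "R ^ n * m q \<le> G * m q"
        unfolding G_def using R m0[OF qn] by (intro mult_right_mono power_increasing) auto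
      then have "m i * e i \<le> G * m q * e q"
        using miq emono[OF i qn] q(1) e0[OF i] m0[OF qn] G by (intro mult_mono) auto
      then show ?thesis using C by (simp add: \<mu>_def mult_left_mono mult.assoc)
    qed
    also have "\<dots> \<le> (K q - G * (\<Sum>p\<in>{1..<q}. K p)) * \<mu>"
    proof (rule order.trans[OF _ mult_right_mono[OF _ \<mu>]])
      \<comment> \<open>\<open>Ksum\<close> starts at index 0, the scales at 1. The spare term
        \<open>G * K 0 = G * C\<close> is what remains to dominate
        \<open>C * m i * e i\<close>.\<close>
      have "(\<Sum>p<q. K p) = C + (\<Sum>p\<in>{1..<q}. K p)"
        using qn by (simp add: lessThan_atLeast0 sum.atLeast_Suc_lessThan K_def)
      then have "K q - G * (\<Sum>p\<in>{1..<q}. K p) = C + G * C"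
        unfolding Ksum[of q] by (simp add: algebra_simps)
      then show "C * G \<le> K q - G * (\<Sum>p\<in>{1..<q}. K p)" using C by simp
    qed simp
    also have "\<dots> = K q * \<mu> - (\<Sum>p\<in>{1..<q}. G * K p * \<mu>)"
      by (simp add: left_diff_distrib sum_distrib_left sum_distrib_right mult.assoc)
    also have "(\<Sum>p\<in>{1..<q}. G * K p * \<mu>) = (\<Sum>p\<in>{1..n} - {q}. if p < q then G * K p * \<mu> else 0)"
      by (rule sum.mono_neutral_cong_left) (use qn in auto)
    also have "K q * \<mu> - \<dots> = M i q * e q + (\<Sum>p\<in>{1..n} - {q}. - (if p < q then G * K p * \<mu> else 0))"
      using qT q(1) by (simp add: M_def \<mu>_def sum_negf)
    also have "\<dots> \<le> M i q * e q + (\<Sum>p\<in>{1..n} - {q}. M i p * e p)"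
      by (intro add_left_mono sum_mono term_ge)
    also have "\<dots> = (\<Sum>p\<in>{1..n}. M i p * e p)" using qn by (simp add: sum.remove)
    finally show "C * m i * e i \<le> (\<Sum>p\<in>{1..n}. M i p * e p)" .
  next
    fix i p assume i: "i \<in> {1..n}" and p: "p \<in> {1..n}"
    note Mle[OF i p]
    also have "K p * m p \<le> C * (1 + R ^ Suc n) ^ n * m p"
      unfolding K_def G_def[symmetric] using C G p m0[OF p]
      by (intro mult_right_mono mult_left_mono power_increasing) auto
    finally show "M i p \<le> C * (1 + R ^ Suc n) ^ n * m p" .
  qed
qed

section \<open>Oscillation of the solution and truncation error\<close>

text \<open>A single \<open>H\<close> bounds the data, their Lipschitz constants and the boundary
  values, so every later constant is an explicit function of \<open>n\<close>,
  \<open>\<alpha>\<close> and \<open>H\<close> and cannot depend on \<open>\<epsilon>\<close> or on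
  the mesh.\<close>

locale reaction_diffusion =
  fixes n :: nat and a :: "nat \<Rightarrow> nat \<Rightarrow> real \<Rightarrow> real" and f :: "nat \<Rightarrow> real \<Rightarrow> real"
    and \<alpha> H :: real and \<epsilon> :: "nat \<Rightarrow> real" and u u' u'' :: "nat \<Rightarrow> real \<Rightarrow> real"
  assumes n: "1 \<le> n" and \<alpha>: "0 < \<alpha>"
    and a_bound: "i \<in> {1..n} \<Longrightarrow> j \<in> {1..n} \<Longrightarrow> x \<in> {0..1} \<Longrightarrow> \<bar>a i j x\<bar> \<le> H"
    and f_bound: "i \<in> {1..n} \<Longrightarrow> x \<in> {0..1} \<Longrightarrow> \<bar>f i x\<bar> \<le> H"
    and a_lip: "i \<in> {1..n} \<Longrightarrow> j \<in> {1..n} \<Longrightarrow> x \<in> {0..1} \<Longrightarrow> y \<in> {0..1} \<Longrightarrow>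
      \<bar>a i j x - a i j y\<bar> \<le> H * \<bar>x - y\<bar>"
    and f_lip: "i \<in> {1..n} \<Longrightarrow> x \<in> {0..1} \<Longrightarrow> y \<in> {0..1} \<Longrightarrow> \<bar>f i x - f i y\<bar> \<le> H * \<bar>x - y\<bar>"
    and off: "i \<in> {1..n} \<Longrightarrow> j \<in> {1..n} \<Longrightarrow> i \<noteq> j \<Longrightarrow> x \<in> {0..1} \<Longrightarrow> a i j x \<le> 0"
    and row: "i \<in> {1..n} \<Longrightarrow> x \<in> {0..1} \<Longrightarrow> \<alpha> < (\<Sum>j\<in>{1..n}. a i j x)"
    and eps: "i \<in> {1..n} \<Longrightarrow> 0 < \<epsilon> i" "i \<in> {1..n} \<Longrightarrow> \<epsilon> i \<le> 1"
    and eps_mono: "strict_mono_on {1..n} \<epsilon>"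
    and cont: "i \<in> {1..n} \<Longrightarrow> continuous_on {0..1} (u i)"
    and bdry: "i \<in> {1..n} \<Longrightarrow> \<bar>u i 0\<bar> \<le> H" "i \<in> {1..n} \<Longrightarrow> \<bar>u i 1\<bar> \<le> H"
    and u': "i \<in> {1..n} \<Longrightarrow> x \<in> {0<..<1} \<Longrightarrow> (u i has_real_derivative u' i x) (at x)"
    and u'': "i \<in> {1..n} \<Longrightarrow> x \<in> {0<..<1} \<Longrightarrow> (u' i has_real_derivative u'' i x) (at x)"
    and ode: "i \<in> {1..n} \<Longrightarrow> x \<in> {0<..<1} \<Longrightarrow> - \<epsilon> i * u'' i x + (\<Sum>j\<in>{1..n}. a i j x * u j x) = f i x"

definition solution_bound :: "real \<Rightarrow> real \<Rightarrow> real" where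
  "solution_bound \<alpha> H = H + H / \<alpha>"

text \<open>This is \<open>2 * B + D\<close> from \<open>slope_bound\<close>, with \<open>B\<close>
  the bound on the solution and \<open>D\<close> the bound on \<open>\<epsilon> i * u'' i\<close> in
  \<open>second_derivative_le\<close>.\<close>

definition slope_const :: "nat \<Rightarrow> real \<Rightarrow> real \<Rightarrow> real" where
  "slope_const n \<alpha> H = 2 * solution_bound \<alpha> H + (H + real n * H * solution_bound \<alpha> H)"

text \<open>The first summand multiplies \<open>h\<close> in the barrier: it is the bound on the
  right-hand side of the increment system divided by \<open>\<alpha>\<close>. The second bounds the
  coefficients from \<open>barrier_coefficients\<close>, where \<open>2 * H / \<alpha>\<close> is
  \<open>R\<close>.\<close>

definition osc_const :: "nat \<Rightarrow> real \<Rightarrow> real \<Rightarrow> real" where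
  "osc_const n \<alpha> H = H * (1 + real n * solution_bound \<alpha> H) / \<alpha>
    + slope_const n \<alpha> H * (1 + (2 * H / \<alpha>) ^ Suc n) ^ n"

context reaction_diffusion
begin

text \<open>The off-diagonal entries are nonpositive, so a row sum lies below its diagonal entry.
  This makes \<open>2 * H / \<alpha>\<close> at least 1, so that its powers increase in the barrier
  construction.\<close>

lemma alpha_less_H: "\<alpha> < H"
proof -
  have 1: "1 \<in> {1..n}" using n by simp
  have "(\<Sum>j\<in>{1..n}. a 1 j 0) = a 1 1 0 + (\<Sum>j\<in>{1..n} - {1}. a 1 j 0)"
    by (rule sum.remove[OF _ 1]) simp
  moreover have "(\<Sum>j\<in>{1..n} - {1}. a 1 j 0) \<le> 0"
    using off[OF 1] by (intro sum_nonpos) auto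
  moreover have "a 1 1 0 \<le> H" using a_bound[OF 1 1, of 0] by simp
  ultimately show ?thesis using row[OF 1, of 0] by simp
qed

lemma H_pos: "0 < H" using alpha_less_H \<alpha> by simp

lemma solution_bound_pos: "0 < solution_bound \<alpha> H"
  using H_pos \<alpha> by (simp add: solution_bound_def add_pos_pos)

lemma slope_const_pos: "0 < slope_const n \<alpha> H"
  using H_pos solution_bound_pos by (simp add: slope_const_def add_pos_nonneg)

lemma solution_le:
  assumes i: "i \<in> {1..n}" and x: "x \<in> {0..1}"
  shows "\<bar>u i x\<bar> \<le> solution_bound \<alpha> H"
proof (rule system_comparison_principle[where I = "{1..n}" and l = 0 and r = 1 and w = u and w' = u' and w'' = u''
      and \<psi> = "\<lambda>i x. solution_bound \<alpha> H" and \<psi>' = "\<lambda>i x. 0" and \<psi>'' = "\<lambda>i x. 0" and b = a and \<epsilon> = \<epsilon>,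
      OF _ _ cont _ _ _ u' u'' _ _ _ eps(1) off _ i x])
  fix i assume i: "i \<in> {1..n}"
  have "H \<le> solution_bound \<alpha> H" using H_pos \<alpha> by (simp add: solution_bound_def)
  then show "\<bar>u i 0\<bar> \<le> solution_bound \<alpha> H" "\<bar>u i 1\<bar> \<le> solution_bound \<alpha> H"
    using bdry[OF i] by auto
  fix x :: real assume x: "x \<in> {0<..<1}"
  then show "0 < (\<Sum>j\<in>{1..n}. a i j x)" using row[OF i, of x] \<alpha> by simp
  have "\<bar>f i x\<bar> \<le> \<alpha> * (H / \<alpha>)" using f_bound[OF i, of x] x \<alpha> by simp
  also have "\<dots> \<le> (\<Sum>j\<in>{1..n}. a i j x) * solution_bound \<alpha> H"
    using row[OF i, of x] x \<alpha> H_pos by (intro mult_mono) (auto simp: solution_bound_def)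
  finally show "\<bar>- \<epsilon> i * u'' i x + (\<Sum>j\<in>{1..n}. a i j x * u j x)\<bar>
      \<le> - \<epsilon> i * 0 + (\<Sum>j\<in>{1..n}. a i j x * solution_bound \<alpha> H)"
    unfolding ode[OF i x] by (simp add: sum_distrib_right)
qed auto

lemma second_derivative_le:
  assumes i: "i \<in> {1..n}" and x: "x \<in> {0<..<1}"
  shows "\<epsilon> i * \<bar>u'' i x\<bar> \<le> H + real n * H * solution_bound \<alpha> H"
proof -
  have "\<bar>\<Sum>j\<in>{1..n}. a i j x * u j x\<bar> \<le> (\<Sum>j\<in>{1..n}. H * solution_bound \<alpha> H)"
  proof (rule order.trans[OF sum_abs sum_mono])
    fix j assume j: "j \<in> {1..n}"
    show "\<bar>a i j x * u j x\<bar> \<le> H * solution_bound \<alpha> H"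
      unfolding abs_mult using a_bound[OF i j, of x] solution_le[OF j, of x] x H_pos
      by (intro mult_mono) auto
  qed
  moreover have "\<epsilon> i * \<bar>u'' i x\<bar> = \<bar>\<epsilon> i * u'' i x\<bar>" using eps(1)[OF i] by (simp add: abs_mult)
  moreover have "\<bar>f i x\<bar> \<le> H" using f_bound[OF i, of x] x by simp
  ultimately show ?thesis using ode[OF i x] by (simp add: mult.assoc)
qed

text \<open>The natural length is \<open>sqrt (\<epsilon> i)\<close>: an interval of this length
  next to the endpoint fits into \<open>[0, 1]\<close> because \<open>\<epsilon> i \<le> 1\<close>,
  and there \<open>slope_bound\<close> applies with constants free of \<open>\<epsilon>\<close>. For
  longer steps the bound on the solution itself is enough.\<close>

lemma boundary_increment:
  assumes i: "i \<in> {1..n}" and h: "0 \<le> h" "h \<le> 1"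
  shows "\<bar>u i h - u i 0\<bar> \<le> slope_const n \<alpha> H * min 1 (h / sqrt (\<epsilon> i))" (is ?left)
    and "\<bar>u i 1 - u i (1 - h)\<bar> \<le> slope_const n \<alpha> H * min 1 (h / sqrt (\<epsilon> i))" (is ?right)
proof -
  define s where "s = sqrt (\<epsilon> i)"
  have s: "0 < s" "s \<le> 1" "s\<^sup>2 = \<epsilon> i"
    using eps[OF i] by (auto simp: s_def)
  have inc: "\<bar>u i y - u i x\<bar> \<le> slope_const n \<alpha> H * ((y - x) / s)"
    if "0 \<le> c" "c + s \<le> 1" "c \<le> x" "x \<le> y" "y \<le> c + s" for c x y
    unfolding slope_const_def
  proof (rule slope_bound[OF s(1) _ u'[OF i] u''[OF i] solution_le[OF i]])
    show "continuous_on {c..c + s} (u i)"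
      by (rule continuous_on_subset[OF cont[OF i]]) (use that in auto)
    show "s\<^sup>2 * \<bar>u'' i t\<bar> \<le> H + real n * H * solution_bound \<alpha> H" if "t \<in> {c<..<c + s}" for t
      unfolding s(3) using that \<open>0 \<le> c\<close> \<open>c + s \<le> 1\<close> by (intro second_derivative_le[OF i]) auto
  qed (use that in auto)
  have triv: "\<bar>u i y - u i x\<bar> \<le> slope_const n \<alpha> H * 1" if "x \<in> {0..1}" "y \<in> {0..1}" for x y
  proof -
    have "0 \<le> H + real n * H * solution_bound \<alpha> H" using H_pos solution_bound_pos by simp
    then show ?thesis
      using solution_le[OF i that(1)] solution_le[OF i that(2)] by (simp add: slope_const_def)
  qed
  show ?left
  proof (cases "h \<le> s")
    case True
    then show ?thesis using inc[of 0 0 h] s h by (auto simp: s_def[symmetric] min_def)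
  next
    case False
    then show ?thesis using triv[of 0 h] s h by (auto simp: s_def[symmetric] min_def field_simps)
  qed
  show ?right
  proof (cases "h \<le> s")
    case True
    then show ?thesis using inc[of "1 - s" "1 - h" 1] s h by (auto simp: s_def[symmetric] min_def)
  next
    case False
    then show ?thesis using triv[of "1 - h" 1] s h by (auto simp: s_def[symmetric] min_def field_simps)
  qed
qed

lemma sum_abs_diff_le:
  assumes i: "i \<in> {1..n}" and x: "x \<in> {0..1}" and y: "y \<in> {0..1}"
  shows "\<bar>\<Sum>j\<in>{1..n}. (a i j x - a i j y) * u j y\<bar> \<le> H * \<bar>x - y\<bar> * (real n * solution_bound \<alpha> H)"
proof -
  have "\<bar>\<Sum>j\<in>{1..n}. (a i j x - a i j y) * u j y\<bar> \<le> (\<Sum>j\<in>{1..n}. H * \<bar>x - y\<bar> * solution_bound \<alpha> H)"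
  proof (rule order.trans[OF sum_abs sum_mono])
    fix j assume j: "j \<in> {1..n}"
    show "\<bar>(a i j x - a i j y) * u j y\<bar> \<le> H * \<bar>x - y\<bar> * solution_bound \<alpha> H"
      unfolding abs_mult using a_lip[OF i j x y] solution_le[OF j y] H_pos by (intro mult_mono) auto
  qed
  then show ?thesis by (simp add: algebra_simps)
qed

text \<open>The increment over a fixed step \<open>h\<close> satisfies a system of the same kind, so it is estimated by
  the comparison principle, with no recourse to a third derivative of the solution.\<close>

lemma oscillation_le:
  assumes i: "i \<in> {1..n}" and h: "0 \<le> h" and x: "0 \<le> x" "x + h \<le> 1"
  shows "\<bar>u i (x + h) - u i x\<bar> \<le> osc_const n \<alpha> H * (h + (\<Sum>p\<in>{1..n}. min 1 (h / sqrt (\<epsilon> p)) *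
    (exp (- sqrt (\<alpha> / \<epsilon> p) * x) + exp (- sqrt (\<alpha> / \<epsilon> p) * (1 - (x + h))))))"
proof -
  define L where "L = 1 - h"
  have L: "0 \<le> L" "L \<le> 1" using x h by (auto simp: L_def)
  define m where "m i = min 1 (h / sqrt (\<epsilon> i))" for i
  define r where "r i = sqrt (\<alpha> / \<epsilon> i)" for i
  define C where "C = slope_const n \<alpha> H"
  define K where "K = C * (1 + (2 * H / \<alpha>) ^ Suc n) ^ n"
  define K0 where "K0 = H * (1 + real n * solution_bound \<alpha> H) / \<alpha>"
  have K0: "0 \<le> K0" using H_pos solution_bound_pos \<alpha> by (simp add: K0_def)
  have K: "0 \<le> K" using H_pos slope_const_pos \<alpha> by (simp add: K_def C_def)
  have m0: "0 \<le> m p" if "p \<in> {1..n}" for p using h eps(1)[OF that] by (simp add: m_def)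
  have r2: "(r p)\<^sup>2 = \<alpha> / \<epsilon> p" if "p \<in> {1..n}" for p
    using \<alpha> eps(1)[OF that] by (simp add: r_def)
  obtain M where M1: "\<And>i p b. \<lbrakk>i \<in> {1..n}; p \<in> {1..n}; \<And>j. j \<in> {1..n} \<Longrightarrow> j \<noteq> i \<Longrightarrow> b j \<le> 0;
      \<alpha> \<le> (\<Sum>j\<in>{1..n}. b j); b i \<le> H\<rbrakk>
      \<Longrightarrow> \<alpha> * (\<epsilon> i / \<epsilon> p) * M i p \<le> (\<Sum>j\<in>{1..n}. b j * M j p)"
    and M2: "\<And>i e. \<lbrakk>i \<in> {1..n}; \<And>p. p \<in> {1..n} \<Longrightarrow> 0 \<le> e p;
      \<And>p q. p \<in> {1..n} \<Longrightarrow> q \<in> {1..n} \<Longrightarrow> p \<le> q \<Longrightarrow> e p \<le> e q\<rbrakk>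
      \<Longrightarrow> C * m i * e i \<le> (\<Sum>p\<in>{1..n}. M i p * e p)"
    and M3: "\<And>i p. i \<in> {1..n} \<Longrightarrow> p \<in> {1..n} \<Longrightarrow> M i p \<le> K * m p"
    unfolding m_def K_def
    by (rule barrier_coefficients[of \<alpha> H h C n \<epsilon>])
       (use \<alpha> alpha_less_H h slope_const_pos eps(1) eps_mono in \<open>auto simp: C_def\<close>)
  \<comment> \<open>The left and the right layer of scale \<open>\<epsilon> p\<close> on
    \<open>[0, L]\<close>, the domain of the increment. The second derivative of each is
    \<open>(r p)\<^sup>2\<close>, that is \<open>\<alpha> / \<epsilon> p\<close>, times the layer
    itself.\<close>
  define E where "E p t = exp (- r p * t) + exp (- r p * (L - t))" for p t
  define E' where "E' p t = - r p * exp (- r p * t) + r p * exp (- r p * (L - t))" for p t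
  define \<psi> where "\<psi> i t = K0 * h + (\<Sum>p\<in>{1..n}. M i p * E p t)" for i t
  define \<psi>' where "\<psi>' i t = (\<Sum>p\<in>{1..n}. M i p * E' p t)" for i t
  define \<psi>'' where "\<psi>'' i t = (\<Sum>p\<in>{1..n}. M i p * ((r p)\<^sup>2 * E p t))" for i t
  have E: "(E p has_real_derivative E' p t) (at t)" for p t
    unfolding E_def E'_def by (auto intro!: derivative_eq_intros)
  have E': "(E' p has_real_derivative (r p)\<^sup>2 * E p t) (at t)" for p t
    unfolding E_def E'_def by (auto intro!: derivative_eq_intros simp: power2_eq_square algebra_simps)
  have E0: "0 \<le> E p t" for p t by (simp add: E_def)
  have r_anti: "r q \<le> r p" if "p \<in> {1..n}" "q \<in> {1..n}" "p \<le> q" for p q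
  proof -
    have "\<epsilon> p \<le> \<epsilon> q" using strict_mono_onD[OF eps_mono that(1,2)] that(3) by (cases "p = q") auto
    then show ?thesis using eps(1) that \<alpha> by (simp add: r_def frac_le)
  qed
  \<comment> \<open>At either end one family of exponentials equals 1 and the opposite one equals
    \<open>exp (- r p * L)\<close>. Since coefficients may be negative, \<open>M2\<close> is needed
    for the opposite family too, merely to see that its sum is nonnegative; it applies because
    larger scales decay more slowly.\<close>
  have \<psi>_end: "C * m k \<le> \<psi> k t" if k: "k \<in> {1..n}" and t: "t = 0 \<or> t = L" for k t
  proof -
    have "C * m k * exp (- r k * 0) \<le> (\<Sum>p\<in>{1..n}. M k p * exp (- r p * 0))"
      by (rule M2[OF k]) auto
    moreover have "C * m k * exp (- r k * L) \<le> (\<Sum>p\<in>{1..n}. M k p * exp (- r p * L))"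
      by (rule M2[OF k]) (use r_anti L in \<open>auto intro: mult_right_mono\<close>)
    moreover have "0 \<le> C * m k * exp (- r k * L)" using m0[OF k] slope_const_pos by (simp add: C_def)
    moreover have "0 \<le> K0 * h" using K0 h by simp
    ultimately show ?thesis
      using t by (auto simp: \<psi>_def E_def distrib_left sum.distrib)
  qed
  define w where "w i t = u i (t + h) - u i t" for i t
  define w' where "w' i t = u' i (t + h) - u' i t" for i t
  define w'' where "w'' i t = u'' i (t + h) - u'' i t" for i t
  have "\<bar>w i x\<bar> \<le> \<psi> i x"
  proof (rule system_comparison_principle[where I = "{1..n}" and l = 0 and r = L and w = w and w' = w'
      and w'' = w'' and \<psi> = \<psi> and \<psi>' = \<psi>' and \<psi>'' = \<psi>'' and b = "\<lambda>i j t. a i j (t + h)" and \<epsilon> = \<epsilon>,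
      OF _ L(1) _ _ _ _ _ _ _ _ _ eps(1) _ _ i])
    show "x \<in> {0..L}" using x by (auto simp: L_def)
    fix k assume k: "k \<in> {1..n}"
    show "continuous_on {0..L} (w k)"
      unfolding w_def
      by (intro continuous_intros continuous_on_subset[OF cont[OF k]]
          continuous_on_compose2[OF cont[OF k], of _ "\<lambda>t. t + h"])
         (use h in \<open>auto simp: L_def\<close>)
    show "continuous_on {0..L} (\<psi> k)"
      unfolding \<psi>_def E_def by (intro continuous_intros)
    have "\<bar>w k 0\<bar> \<le> C * m k" "\<bar>w k L\<bar> \<le> C * m k"
      using boundary_increment[OF k h, folded m_def C_def] x h by (auto simp: w_def L_def)
    then show "\<bar>w k 0\<bar> \<le> \<psi> k 0" "\<bar>w k L\<bar> \<le> \<psi> k L"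
      using \<psi>_end[OF k, of 0] \<psi>_end[OF k, of L] by auto
    fix t assume t: "t \<in> {0<..<L}"
    have th: "t \<in> {0<..<1}" "t + h \<in> {0<..<1}" using t h by (auto simp: L_def)
    then have th': "t \<in> {0..1}" "t + h \<in> {0..1}" by auto
    show "(w k has_real_derivative w' k t) (at t)"
      unfolding w_def w'_def
      using DERIV_shift[THEN iffD1, OF u'[OF k th(2)]] u'[OF k th(1)] by (intro DERIV_diff)
    show "(w' k has_real_derivative w'' k t) (at t)"
      unfolding w'_def w''_def
      using DERIV_shift[THEN iffD1, OF u''[OF k th(2)]] u''[OF k th(1)] by (intro DERIV_diff)
    show "(\<psi> k has_real_derivative \<psi>' k t) (at t)"
      unfolding \<psi>_def \<psi>'_def
      by (rule derivative_eq_intros DERIV_sum DERIV_cmult E refl | simp)+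
    show "(\<psi>' k has_real_derivative \<psi>'' k t) (at t)"
      unfolding \<psi>'_def \<psi>''_def by (intro DERIV_sum DERIV_cmult E')
    show "0 < (\<Sum>j\<in>{1..n}. a k j (t + h))" using row[OF k th'(2)] \<alpha> by simp
    show "a k j (t + h) \<le> 0" if "j \<in> {1..n}" "k \<noteq> j" for j using off[OF k that th'(2)] .
    \<comment> \<open>With the matrix taken at \<open>t + h\<close>, the difference of the two
      equations leaves only the variation of \<open>f\<close> and that of \<open>A\<close> against
      the bounded factor \<open>u j t\<close>, both of order \<open>h\<close>.\<close>
    have "- \<epsilon> k * w'' k t + (\<Sum>j\<in>{1..n}. a k j (t + h) * w j t)
      = f k (t + h) - f k t - (\<Sum>j\<in>{1..n}. (a k j (t + h) - a k j t) * u j t)"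
      using ode[OF k th(1)] ode[OF k th(2)]
      by (simp add: w_def w''_def algebra_simps sum_subtractf)
    also have "\<bar>\<dots>\<bar> \<le> H * h + H * h * (real n * solution_bound \<alpha> H)"
      using f_lip[OF k th'(2,1)] sum_abs_diff_le[OF k th'(2,1)] h by simp
    also have "\<dots> = \<alpha> * (K0 * h)" using \<alpha> by (simp add: K0_def field_simps)
    also have "\<dots> \<le> (\<Sum>j\<in>{1..n}. a k j (t + h)) * (K0 * h)"
      using row[OF k th'(2)] K0 h by (intro mult_right_mono) auto
    \<comment> \<open>The added sum is the system applied to the layer part of
      \<open>\<psi>\<close>, sorted by \<open>E p t\<close>. The first property of \<open>M\<close>
      says exactly that each of its coefficients is nonnegative.\<close>
    also have "\<dots> \<le> (\<Sum>j\<in>{1..n}. a k j (t + h)) * (K0 * h)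
      + (\<Sum>p\<in>{1..n}. E p t * ((\<Sum>j\<in>{1..n}. a k j (t + h) * M j p) - \<alpha> * (\<epsilon> k / \<epsilon> p) * M k p))"
    proof (subst le_add_same_cancel1, intro sum_nonneg mult_nonneg_nonneg E0)
      fix p assume p: "p \<in> {1..n}"
      have "\<alpha> * (\<epsilon> k / \<epsilon> p) * M k p \<le> (\<Sum>j\<in>{1..n}. a k j (t + h) * M j p)"
        by (rule M1[OF k p]) (use off[OF k _ _ th'(2)] row[OF k th'(2)] a_bound[OF k k th'(2)] in auto)
      then show "0 \<le> (\<Sum>j\<in>{1..n}. a k j (t + h) * M j p) - \<alpha> * (\<epsilon> k / \<epsilon> p) * M k p" by simp
    qed
    also have "\<dots> = - \<epsilon> k * \<psi>'' k t + (\<Sum>j\<in>{1..n}. a k j (t + h) * \<psi> j t)"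
    proof -
      have "(\<Sum>j\<in>{1..n}. a k j (t + h) * \<psi> j t) = (\<Sum>j\<in>{1..n}. a k j (t + h)) * (K0 * h)
        + (\<Sum>j\<in>{1..n}. \<Sum>p\<in>{1..n}. E p t * (a k j (t + h) * M j p))"
        by (simp add: \<psi>_def distrib_left sum.distrib sum_distrib_left sum_distrib_right mult_ac)
      also have "(\<Sum>j\<in>{1..n}. \<Sum>p\<in>{1..n}. E p t * (a k j (t + h) * M j p))
        = (\<Sum>p\<in>{1..n}. E p t * (\<Sum>j\<in>{1..n}. a k j (t + h) * M j p))"
        by (subst sum.swap) (simp add: sum_distrib_left)
      finally have s: "(\<Sum>j\<in>{1..n}. a k j (t + h) * \<psi> j t) = (\<Sum>j\<in>{1..n}. a k j (t + h)) * (K0 * h)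
        + (\<Sum>p\<in>{1..n}. E p t * (\<Sum>j\<in>{1..n}. a k j (t + h) * M j p))" .
      have "\<epsilon> k * \<psi>'' k t = (\<Sum>p\<in>{1..n}. E p t * (\<alpha> * (\<epsilon> k / \<epsilon> p) * M k p))"
        unfolding \<psi>''_def sum_distrib_left by (intro sum.cong refl) (simp add: r2)
      then show ?thesis unfolding s by (simp add: right_diff_distrib sum_subtractf)
    qed
    finally show "\<bar>- \<epsilon> k * w'' k t + (\<Sum>j\<in>{1..n}. a k j (t + h) * w j t)\<bar>
      \<le> - \<epsilon> k * \<psi>'' k t + (\<Sum>j\<in>{1..n}. a k j (t + h) * \<psi> j t)" .
  qed auto
  also have "\<psi> i x \<le> K0 * h + (\<Sum>p\<in>{1..n}. K * m p * E p x)"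
    unfolding \<psi>_def by (intro add_left_mono sum_mono mult_right_mono M3[OF i] E0)
  also have "\<dots> = K0 * h + K * (\<Sum>p\<in>{1..n}. m p * E p x)" by (simp add: sum_distrib_left mult.assoc)
  also have "\<dots> \<le> (K0 + K) * h + (K0 + K) * (\<Sum>p\<in>{1..n}. m p * E p x)"
    using K K0 h m0 E0 by (intro add_mono mult_right_mono sum_nonneg mult_nonneg_nonneg) auto
  also have "\<dots> = osc_const n \<alpha> H * (h + (\<Sum>p\<in>{1..n}. m p * E p x))"
    by (simp add: osc_const_def K0_def K_def C_def distrib_left)
  finally show ?thesis
    by (simp add: w_def m_def E_def r_def L_def algebra_simps)
qed

lemma truncation_error_le:
  assumes i: "i \<in> {1..n}" and x: "0 \<le> x (j - 1)" "x (j - 1) < x j" "x j < x (j + 1)" "x (j + 1) \<le> 1"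
    and step: "x j - x (j - 1) \<le> \<delta>" "x (j + 1) - x j \<le> \<delta>"
    and osc: "\<And>l t. l \<in> {1..n} \<Longrightarrow> t \<in> {x (j - 1)..x (j + 1)} \<Longrightarrow> \<bar>u l t - u l (x j)\<bar> \<le> \<omega>"
  shows "\<bar>- \<epsilon> i * delta2 x (\<lambda>k. u i (x k)) j + (\<Sum>l\<in>{1..n}. a i l (x j) * u l (x j)) - f i (x j)\<bar>
    \<le> H * (1 + real n * solution_bound \<alpha> H) * \<delta> + real n * H * \<omega>"
proof -
  obtain \<xi> where \<xi>: "x (j - 1) < \<xi>" "\<xi> < x (j + 1)" "delta2 x (\<lambda>k. u i (x k)) j = u'' i \<xi>"
  proof (rule second_difference_mean_value[of x j "u i" "u' i" "u'' i", OF x(2,3)])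
    show "continuous_on {x (j - 1)..x (j + 1)} (u i)"
      by (rule continuous_on_subset[OF cont[OF i]]) (use x in auto)
  qed (use x u'[OF i] u''[OF i] in auto)
  have I: "x j \<in> {0..1}" "\<xi> \<in> {0..1}" "\<xi> \<in> {0<..<1}" using x \<xi> by auto
  have d: "\<bar>x j - \<xi>\<bar> \<le> \<delta>" using \<xi> step x by auto
  \<comment> \<open>The change of \<open>A u\<close> between \<open>x j\<close> and
    \<open>\<xi>\<close> is split so that \<open>S1\<close> carries the variation of
    \<open>A\<close> and \<open>S2\<close> that of \<open>u\<close>; the oscillation bound is spent
    on \<open>S2\<close> alone.\<close>
  define S1 where "S1 = (\<Sum>l\<in>{1..n}. (a i l (x j) - a i l \<xi>) * u l \<xi>)"
  define S2 where "S2 = (\<Sum>l\<in>{1..n}. a i l (x j) * (u l (x j) - u l \<xi>))"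
  have "- \<epsilon> i * delta2 x (\<lambda>k. u i (x k)) j + (\<Sum>l\<in>{1..n}. a i l (x j) * u l (x j)) - f i (x j)
    = S1 + S2 - (f i (x j) - f i \<xi>)"
    unfolding \<xi>(3) S1_def S2_def using ode[OF i I(3)] by (simp add: algebra_simps sum_subtractf)
  moreover have "\<bar>S1\<bar> \<le> H * \<delta> * (real n * solution_bound \<alpha> H)"
    unfolding S1_def using d H_pos solution_bound_pos
    by (intro order.trans[OF sum_abs_diff_le[OF i I(1,2)]] mult_right_mono mult_left_mono) auto
  moreover have "\<bar>S2\<bar> \<le> (\<Sum>l\<in>{1..n}. H * \<omega>)"
    unfolding S2_def
  proof (rule order.trans[OF sum_abs sum_mono])
    fix l assume l: "l \<in> {1..n}"
    have "\<bar>u l (x j) - u l \<xi>\<bar> \<le> \<omega>"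
      using osc[OF l, of \<xi>] \<xi> by (simp add: abs_minus_commute)
    then show "\<bar>a i l (x j) * (u l (x j) - u l \<xi>)\<bar> \<le> H * \<omega>"
      unfolding abs_mult using a_bound[OF i l I(1)] H_pos by (intro mult_mono) auto
  qed
  moreover have "\<bar>f i (x j) - f i \<xi>\<bar> \<le> H * \<delta>"
    using f_lip[OF i I(1,2)] mult_left_mono[OF d, of H] H_pos by linarith
  ultimately show ?thesis by (simp add: algebra_simps)
qed

end

section \<open>The Shishkin mesh\<close>

text \<open>\<open>shishkin_mesh\<close> enumerates a union of sets in increasing order, which hides
  the piece that a given index belongs to. A strictly increasing list with the same elements must be
  that enumeration, and building it piece by piece reveals the piece of every step.\<close>

lemma glued_uniform_meshes:
  fixes b :: "nat \<Rightarrow> real" and M :: "nat \<Rightarrow> nat"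
  assumes "\<forall>k<m. b k < b (Suc k)" and "\<forall>k<m. 0 < M k"
  shows "\<exists>xs. sorted_wrt (<) xs \<and> set xs = insert (b 0) (\<Union>k<m. uniform_mesh (b k) (b (Suc k)) (M k)) \<and>
    length xs = Suc (\<Sum>k<m. M k) \<and> xs ! 0 = b 0 \<and> xs ! (\<Sum>k<m. M k) = b m \<and> (\<forall>y\<in>set xs. y \<le> b m) \<and>
    (\<forall>j<(\<Sum>k<m. M k). \<exists>k<m. b k \<le> xs ! j \<and> xs ! Suc j \<le> b (Suc k) \<and>
      xs ! Suc j - xs ! j = (b (Suc k) - b k) / real (M k))"
  using assms
proof (induction m)
  case 0
  show ?case by (rule exI[of _ "[b 0]"]) auto
next
  case (Suc m)
  define S where "S = (\<Sum>k<m. M k)"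
  have prems: "\<forall>k<m. b k < b (Suc k)" "\<forall>k<m. 0 < M k" using Suc.prems by auto
  obtain xs where xs: "sorted_wrt (<) xs"
      "set xs = insert (b 0) (\<Union>k<m. uniform_mesh (b k) (b (Suc k)) (M k))"
      "length xs = Suc S" "xs ! 0 = b 0" "xs ! S = b m" "\<And>y. y \<in> set xs \<Longrightarrow> y \<le> b m"
      "\<And>j. j < S \<Longrightarrow> \<exists>k<m. b k \<le> xs ! j \<and> xs ! Suc j \<le> b (Suc k) \<and>
        xs ! Suc j - xs ! j = (b (Suc k) - b k) / real (M k)"
    using Suc.IH[OF prems] unfolding S_def
    by (elim exE conjE) blast
  define d where "d = (b (Suc m) - b m) / real (M m)"
  have d: "0 < d" "real (M m) * d = b (Suc m) - b m"
    using Suc.prems by (auto simp: d_def)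
  \<comment> \<open>The index starts at 1 because the left end \<open>b m\<close> of the new piece
    is already the last entry of \<open>xs\<close>.\<close>
  define ys where "ys = map (\<lambda>k. b m + real k * d) [1..<Suc (M m)]"
  have nth: "(xs @ ys) ! (S + t) = b m + real t * d" if "t \<le> M m" for t
  proof (cases t)
    case 0
    then show ?thesis using xs(3,5) by (simp add: nth_append)
  next
    case (Suc t')
    then show ?thesis
      using xs(3) that by (simp add: nth_append ys_def del: upt_Suc)
  qed
  have ys_set: "set ys = (\<lambda>k. b m + real k * d) ` {1..M m}"
    by (auto simp: ys_def simp del: upt_Suc)
  have mesh: "uniform_mesh (b m) (b (Suc m)) (M m) = insert (b m) (set ys)"
  proof -
    have "{0..M m} = insert 0 {1..M m}" by auto
    then show ?thesis unfolding uniform_mesh_def ys_set d_def by simp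
  qed
  have bm: "b m \<in> set xs" using xs(3,5) by (metis lessI nth_mem)
  have S': "(\<Sum>k<Suc m. M k) = S + M m" by (simp add: S_def)
  have ys_le: "b m < y" "y \<le> b (Suc m)" if y: "y \<in> set ys" for y
  proof -
    obtain k where k: "k \<in> {1..M m}" "y = b m + real k * d" using y unfolding ys_set by auto
    then show "b m < y" using d by simp
    have "real k * d \<le> real (M m) * d" using k d by (intro mult_right_mono) auto
    then show "y \<le> b (Suc m)" using k(2) d(2) by simp
  qed
  have "sorted_wrt (<) ys"
    unfolding ys_def sorted_wrt_map
    by (rule sorted_wrt_mono_rel[OF _ sorted_wrt_upt]) (use d in auto)
  show ?case
  proof (intro exI[of _ "xs @ ys"] conjI allI impI ballI)
    show "sorted_wrt (<) (xs @ ys)"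
      unfolding sorted_wrt_append using xs(1,6) ys_le(1) \<open>sorted_wrt (<) ys\<close> by fastforce
    show "set (xs @ ys) = insert (b 0) (\<Union>k<Suc m. uniform_mesh (b k) (b (Suc k)) (M k))"
      using bm by (auto simp: lessThan_Suc mesh xs(2)[symmetric])
        (use xs(2) in auto)
    show "length (xs @ ys) = Suc (\<Sum>k<Suc m. M k)"
      using xs(3) unfolding S' by (simp add: ys_def del: upt_Suc)
    show "(xs @ ys) ! 0 = b 0" using xs(3,4) by (simp add: nth_append)
    show "(xs @ ys) ! (\<Sum>k<Suc m. M k) = b (Suc m)"
      unfolding S' using nth[of "M m"] d(2) by simp
    show "y \<le> b (Suc m)" if "y \<in> set (xs @ ys)" for y
      using that xs(6)[of y] ys_le(2)[of y] Suc.prems(1) by fastforce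
    fix j assume j: "j < (\<Sum>k<Suc m. M k)"
    show "\<exists>k<Suc m. b k \<le> (xs @ ys) ! j \<and> (xs @ ys) ! Suc j \<le> b (Suc k) \<and>
      (xs @ ys) ! Suc j - (xs @ ys) ! j = (b (Suc k) - b k) / real (M k)"
    proof (cases "j < S")
      case True
      then show ?thesis using xs(7)[OF True] xs(3) by (auto simp: nth_append intro: less_SucI)
    next
      case False
      define t where "t = j - S"
      have t: "j = S + t" "Suc t \<le> M m" using False j unfolding S' by (auto simp: t_def)
      have "real (Suc t) * d \<le> real (M m) * d" using t d by (intro mult_right_mono) auto
      then have "b m \<le> (xs @ ys) ! j \<and> (xs @ ys) ! Suc j \<le> b (Suc m) \<and>
          (xs @ ys) ! Suc j - (xs @ ys) ! j = d"
        using nth[of t] nth[of "Suc t"] t d by (simp add: algebra_simps)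
      then show ?thesis unfolding d_def by blast
    qed
  qed
qed

text \<open>The transition points are extended by \<open>0\<close> on the left and by \<open>1/2\<close> on the right, so that the
  recursion defining them has the same form for all indices \<open>1, \<dots>, n\<close>.\<close>

definition layer_point :: "nat \<Rightarrow> real \<Rightarrow> (nat \<Rightarrow> real) \<Rightarrow> nat \<Rightarrow> nat \<Rightarrow> real" where
  "layer_point n \<alpha> \<epsilon> N k =
    (if k = 0 then 0 else if k \<le> n then transition_point n \<alpha> \<epsilon> N k else 1 / 2)"

locale shishkin =
  fixes n :: nat and \<alpha> :: real and \<epsilon> :: "nat \<Rightarrow> real" and N :: nat
  assumes n: "1 \<le> n" and \<alpha>: "0 < \<alpha>" and eps: "i \<in> {1..n} \<Longrightarrow> 0 < \<epsilon> i"
    and eps_mono: "strict_mono_on {1..n} \<epsilon>" and N: "1 < N" and adm: "admissible n N"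
begin

abbreviation "s \<equiv> layer_point n \<alpha> \<epsilon> N"

lemma layer_point_rec:
  "k \<in> {1..n} \<Longrightarrow> s k = min (s (Suc k) / 2) (sqrt (\<epsilon> k / \<alpha>) * ln (real N))"
  by (auto simp: layer_point_def transition_point.simps[of n \<alpha> \<epsilon> N k])

lemma layer_point_0: "s 0 = 0" and layer_point_last: "s (Suc n) = 1 / 2"
  by (auto simp: layer_point_def)

lemma layer_point_pos:
  assumes "1 \<le> k" "k \<le> Suc n"
  shows "0 < s k"
  using assms(2,1)
proof (induction k rule: inc_induct)
  case base
  then show ?case by (simp add: layer_point_last)
next
  case (step m)
  then show ?case using eps[of m] \<alpha> N by (simp add: layer_point_rec)
qed

lemma layer_point_less:
  assumes "k \<le> n"
  shows "s k < s (Suc k)"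
proof (cases "k = 0")
  case True
  then show ?thesis using layer_point_pos[of 1] by (simp add: layer_point_0)
next
  case False
  then show ?thesis using layer_point_rec[of k] layer_point_pos[of "Suc k"] assms by auto
qed

lemma layer_point_mono:
  assumes "k \<le> l" "l \<le> Suc n"
  shows "s k \<le> s l"
  using assms
proof (induction l rule: dec_induct)
  case (step m)
  then show ?case using layer_point_less[of m] by simp
qed simp

lemma layer_point_nonneg: "k \<le> Suc n \<Longrightarrow> 0 \<le> s k"
  using layer_point_mono[of 0 k] by (simp add: layer_point_0)

lemma layer_point_le_half: "k \<le> Suc n \<Longrightarrow> s k \<le> 1 / 2"
  using layer_point_mono[of k "Suc n"] by (simp add: layer_point_last)

text \<open>Let \<open>p \<le> k\<close>. If the minimum defining \<open>s q\<close> is the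
  logarithmic branch for some \<open>q\<close> from \<open>p\<close> to \<open>k\<close>, then
  beyond \<open>s k\<close> the exponential of scale \<open>q\<close>, and all the more that of the
  smaller scale \<open>p\<close>, has dropped to \<open>1 / N\<close>. Otherwise all these points
  arise by halving, so \<open>s (Suc k)\<close> is \<open>s p\<close> times a power of 2. If
  \<open>p > k\<close>, monotonicity already gives the first alternative.\<close>

lemma layer_dichotomy:
  assumes p: "p \<in> {1..n}" and k: "k \<le> n"
  shows "s (Suc k) \<le> 2 ^ n * (sqrt (\<epsilon> p / \<alpha>) * ln (real N)) \<or>
    (\<forall>t\<ge>s k. exp (- sqrt (\<alpha> / \<epsilon> p) * t) \<le> 1 / real N)"
proof -
  have sp: "s p \<le> sqrt (\<epsilon> p / \<alpha>) * ln (real N)" using layer_point_rec[OF p] by simp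
  have pow: "2 ^ r * s p \<le> 2 ^ n * (sqrt (\<epsilon> p / \<alpha>) * ln (real N))" if "r \<le> n" for r
    using sp layer_point_pos[of p] p that by (intro mult_mono power_increasing) auto
  show ?thesis
  proof (cases "p \<le> Suc k")
    case False
    then have "s (Suc k) \<le> 2 ^ 0 * s p" using layer_point_mono[of "Suc k" p] p by simp
    then show ?thesis using pow[of 0] by simp
  next
    case True
    have "1 \<le> p" using p by simp
    with True have "s (Suc k) \<le> 2 ^ (Suc k - p) * s p \<or>
      (\<exists>q\<in>{p..k}. s q = sqrt (\<epsilon> q / \<alpha>) * ln (real N))"
    proof (induction p rule: inc_induct)
      case base
      then show ?case by simp
    next
      case (step m)
      have m: "m \<in> {1..n}" using step k by auto
      consider "s m = sqrt (\<epsilon> m / \<alpha>) * ln (real N)" | "s (Suc m) = 2 * s m"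
        using layer_point_rec[OF m] by linarith
      then show ?case
      proof cases
        case 1
        then show ?thesis using step by auto
      next
        case 2
        have "2 ^ (Suc k - m) * s m = 2 ^ (Suc k - Suc m) * s (Suc m)"
          using step(2) unfolding 2 by (simp add: Suc_diff_le)
        then show ?thesis using step.IH by auto
      qed
    qed
    then show ?thesis
    proof
      assume "s (Suc k) \<le> 2 ^ (Suc k - p) * s p"
      moreover have "Suc k - p \<le> n" using p k by auto
      ultimately show ?thesis using pow[of "Suc k - p"] by linarith
    next
      assume "\<exists>q\<in>{p..k}. s q = sqrt (\<epsilon> q / \<alpha>) * ln (real N)"
      then obtain q where q: "q \<in> {p..k}" "s q = sqrt (\<epsilon> q / \<alpha>) * ln (real N)" by blast
      have qn: "q \<in> {1..n}" using q p k by auto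
      have "\<epsilon> p \<le> \<epsilon> q" using strict_mono_onD[OF eps_mono p qn] q(1) by (cases "p = q") auto
      then have r: "sqrt (\<alpha> / \<epsilon> q) \<le> sqrt (\<alpha> / \<epsilon> p)"
        using eps[OF p] eps[OF qn] \<alpha> by (simp add: frac_le)
      have "exp (- sqrt (\<alpha> / \<epsilon> p) * t) \<le> 1 / real N" if t: "s k \<le> t" for t
      proof -
        have "s q \<le> t" using layer_point_mono[of q k] q k t by simp
        have "ln (real N) = sqrt (\<alpha> / \<epsilon> q) * s q"
          using eps[OF qn] \<alpha> unfolding q(2) mult.assoc[symmetric] real_sqrt_mult[symmetric] by simp
        also have "\<dots> \<le> sqrt (\<alpha> / \<epsilon> p) * t"
          using r \<open>s q \<le> t\<close> layer_point_nonneg[of q] qn eps[OF p] \<alpha> by (intro mult_mono) auto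
        finally have "exp (- sqrt (\<alpha> / \<epsilon> p) * t) \<le> exp (- ln (real N))" by simp
        then show ?thesis using N by (simp add: exp_minus divide_inverse)
      qed
      then show ?thesis by blast
    qed
  qed
qed

text \<open>Arranges the \<open>2 * n + 1\<close> pieces in one chain from left to right, the form
  that \<open>glued_uniform_meshes\<close> requires. The right half is the reflection of the left
  one.\<close>

definition breakpoint :: "nat \<Rightarrow> real" where
  "breakpoint k = (if k \<le> n then s k else 1 - s (2 * n + 1 - k))"

text \<open>Counts in units of \<open>N / 2 ^ (n + 1)\<close>. Truncated subtraction gives the
  exponent 0 at \<open>k = 0\<close> and at \<open>k = 2 * n\<close>, as the two outermost pieces
  require.\<close>

definition num_intervals :: "nat \<Rightarrow> nat" where
  "num_intervals k = 2 ^ (if k = n then n else if k < n then k - 1 else 2 * n - k - 1) * (N div 2 ^ (n + 1))"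

lemma shishkin_points_eq:
  shows num_intervals_pos: "0 < num_intervals k"
    and "shishkin_points n \<alpha> \<epsilon> N = insert (breakpoint 0) (\<Union>k<2 * n + 1. uniform_mesh (breakpoint k) (breakpoint (Suc k)) (num_intervals k))"
    and sum_num_intervals: "(\<Sum>k<2 * n + 1. num_intervals k) = N"
    and num_intervals_ge: "real N \<le> 2 ^ (n + 1) * real (num_intervals k)"
    and num_intervals_middle: "2 * num_intervals n = N"
proof -
  obtain Q where Q: "N = 2 ^ (n + 1) * Q" using adm by (auto simp: admissible_def elim: dvdE)
  have Q0: "0 < Q" using N Q by (cases Q) auto
  have div_eq: "N div 2 ^ (n + 1) = Q" "N div 2 = 2 ^ n * Q" unfolding Q by simp_all
  \<comment> \<open>Shadows the defining equation by one without division, with \<open>N\<close>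
    written as \<open>2 ^ (n + 1) * Q\<close>.\<close>
  have num_intervals_def: "num_intervals k = 2 ^ (if k = n then n else if k < n then k - 1 else 2 * n - k - 1) * Q" for k
    by (simp only: num_intervals_def div_eq)
  have div: "N div 2 ^ (n - i + 2) = 2 ^ (i - 1) * Q" if "i \<in> {1..<n}" for i
  proof -
    have "n + 1 = (i - 1) + (n - i + 2)" using that by simp
    then have "N = 2 ^ (i - 1) * Q * 2 ^ (n - i + 2)" unfolding Q by (metis mult.assoc mult.commute power_add)
    then show ?thesis by simp
  qed
  have idx: "{..<2 * n + 1} = {0} \<union> {1..<n} \<union> {n} \<union> (\<lambda>i. 2 * n - i) ` {1..<n} \<union> {2 * n}"
  proof (intro equalityI subsetI)
    fix k assume "k \<in> {..<2 * n + 1}"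
    then consider "k = 0" | "k \<in> {1..<n}" | "k = n" | "n < k" "k < 2 * n" | "k = 2 * n" by fastforce
    then show "k \<in> {0} \<union> {1..<n} \<union> {n} \<union> (\<lambda>i. 2 * n - i) ` {1..<n} \<union> {2 * n}"
    proof cases
      case 4
      then have "k = 2 * n - (2 * n - k)" "2 * n - k \<in> {1..<n}" by auto
      then show ?thesis by blast
    qed auto
  qed (use n in auto)
  show "0 < num_intervals k" using Q0 by (simp add: num_intervals_def)
  show "2 * num_intervals n = N" unfolding num_intervals_def using Q by simp
  show "real N \<le> 2 ^ (n + 1) * real (num_intervals k)"
    unfolding num_intervals_def using Q Q0 by simp
  have 1: "uniform_mesh 0 (transition_point n \<alpha> \<epsilon> N 1) (N div 2 ^ (n + 1)) = uniform_mesh (breakpoint 0) (breakpoint (Suc 0)) (num_intervals 0)"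
    using n unfolding div_eq num_intervals_def by (simp add: breakpoint_def layer_point_def)
  have 2: "uniform_mesh (transition_point n \<alpha> \<epsilon> N i) (transition_point n \<alpha> \<epsilon> N (i + 1)) (N div 2 ^ (n - i + 2))
    = uniform_mesh (breakpoint i) (breakpoint (Suc i)) (num_intervals i)" if "i \<in> {1..<n}" for i
    using that by (subst div[OF that]) (simp add: breakpoint_def num_intervals_def layer_point_def)
  have 3: "uniform_mesh (transition_point n \<alpha> \<epsilon> N n) (1 - transition_point n \<alpha> \<epsilon> N n) (N div 2)
    = uniform_mesh (breakpoint n) (breakpoint (Suc n)) (num_intervals n)"
    using n unfolding div_eq num_intervals_def by (simp add: breakpoint_def layer_point_def)
  have 4: "uniform_mesh (1 - transition_point n \<alpha> \<epsilon> N (i + 1)) (1 - transition_point n \<alpha> \<epsilon> N i) (N div 2 ^ (n - i + 2))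
    = uniform_mesh (breakpoint (2 * n - i)) (breakpoint (Suc (2 * n - i))) (num_intervals (2 * n - i))" if i: "i \<in> {1..<n}" for i
  proof -
    have "2 * n + 1 - (2 * n - i) = i + 1" "2 * n + 1 - Suc (2 * n - i) = i" "2 * n - (2 * n - i) = i"
      "\<not> 2 * n - i \<le> n" "\<not> Suc (2 * n - i) \<le> n" "2 * n - i \<noteq> n" "\<not> 2 * n - i < n"
      using i by auto
    then show ?thesis using i by (subst div[OF i]) (simp add: breakpoint_def num_intervals_def layer_point_def)
  qed
  have 5: "uniform_mesh (1 - transition_point n \<alpha> \<epsilon> N 1) 1 (N div 2 ^ (n + 1))
    = uniform_mesh (breakpoint (2 * n)) (breakpoint (Suc (2 * n))) (num_intervals (2 * n))"
    using n unfolding div_eq num_intervals_def by (simp add: breakpoint_def layer_point_def)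
  have "breakpoint 0 \<in> uniform_mesh (breakpoint 0) (breakpoint (Suc 0)) (num_intervals 0)"
    unfolding uniform_mesh_def by (rule image_eqI[of _ _ 0]) auto
  then have "insert (breakpoint 0) (\<Union>k<2 * n + 1. uniform_mesh (breakpoint k) (breakpoint (Suc k)) (num_intervals k))
      = (\<Union>k<2 * n + 1. uniform_mesh (breakpoint k) (breakpoint (Suc k)) (num_intervals k))" by auto
  moreover have "shishkin_points n \<alpha> \<epsilon> N = (\<Union>k<2 * n + 1. uniform_mesh (breakpoint k) (breakpoint (Suc k)) (num_intervals k))"
    unfolding shishkin_points_def Let_def idx 1 3 5
    by (simp only: UN_Un image_image UN_insert UN_empty Un_empty_right 2 4 UN_simps(10) cong: SUP_cong)
  ultimately show "shishkin_points n \<alpha> \<epsilon> N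
      = insert (breakpoint 0) (\<Union>k<2 * n + 1. uniform_mesh (breakpoint k) (breakpoint (Suc k)) (num_intervals k))" by simp
  \<comment> \<open>Because \<open>0 - 1 = 0\<close>, the powers are 1, 1, 2, 4, and so on, and
    their sum closes to exactly \<open>2 ^ m\<close>.\<close>
  have half: "(\<Sum>k<Suc m. 2 ^ (k - 1) * Q) = 2 ^ m * Q" for m
  proof (induction m)
    case (Suc m)
    have "(\<Sum>k<Suc (Suc m). 2 ^ (k - 1) * Q) = (\<Sum>k<Suc m. 2 ^ (k - 1) * Q) + 2 ^ m * Q" by simp
    then show ?case unfolding Suc by simp
  qed simp
  have "(\<Sum>k<2 * n + 1. num_intervals k) = (\<Sum>k<n. num_intervals k) + (\<Sum>k\<in>{n..<2 * n + 1}. num_intervals k)"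
    unfolding lessThan_atLeast0 by (rule sum.atLeastLessThan_concat[symmetric]) auto
  also have "(\<Sum>k\<in>{n..<2 * n + 1}. num_intervals k) = num_intervals n + (\<Sum>k\<in>{Suc n..<2 * n + 1}. num_intervals k)"
    by (rule sum.atLeast_Suc_lessThan) simp
  also have "(\<Sum>k\<in>{Suc n..<2 * n + 1}. num_intervals k) = (\<Sum>k<n. num_intervals k)"
    by (rule sum.reindex_bij_witness[of _ "\<lambda>k. 2 * n - k" "\<lambda>k. 2 * n - k"])
       (auto simp: num_intervals_def)
  also have "(\<Sum>k<n. num_intervals k) = (\<Sum>k<Suc (n - 1). 2 ^ (k - 1) * Q)"
    using n by (intro sum.cong) (auto simp: num_intervals_def)
  also have "\<dots> = 2 ^ (n - 1) * Q" by (rule half)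
  also have "2 ^ (n - 1) * Q + (num_intervals n + 2 ^ (n - 1) * Q) = N"
  proof -
    have "2 * 2 ^ (n - 1) = (2 ^ n :: nat)" using n by (cases n) auto
    then have "2 ^ n * Q = 2 * (2 ^ (n - 1) * Q)" by (simp only: mult.assoc[symmetric])
    moreover have "num_intervals n = 2 ^ n * Q" by (simp add: num_intervals_def)
    moreover have "N = 2 * (2 ^ n * Q)" using Q by simp
    ultimately show ?thesis by linarith
  qed
  finally show "(\<Sum>k<2 * n + 1. num_intervals k) = N" .
qed

text \<open>In the last property \<open>k\<close> counts layers from the nearer end of
  \<open>[0, 1]\<close>. Requiring distance \<open>s k\<close> from both ends treats the two halves
  of the mesh alike and makes the bound from \<open>layer_dichotomy\<close> available for left and
  right exponentials at once.\<close>

lemma shishkin_mesh_properties: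
  defines "x \<equiv> shishkin_mesh n \<alpha> \<epsilon> N"
  shows "x 0 = 0" "x N = 1"
    and "\<And>j. j < N \<Longrightarrow> x j < x (Suc j)"
    and "\<And>j. j < N \<Longrightarrow> \<exists>k\<le>n. s k \<le> x j \<and> s k \<le> 1 - x (Suc j) \<and>
      x (Suc j) - x j \<le> 2 ^ (n + 1) * s (Suc k) / real N"
proof -
  have blt: "breakpoint k < breakpoint (Suc k)" if k: "k < 2 * n + 1" for k
  proof -
    consider "k < n" | "k = n" | "n < k" by linarith
    then show ?thesis
    proof cases
      case 1
      then show ?thesis using layer_point_less[of k] by (simp add: breakpoint_def)
    next
      case 2
      then show ?thesis using layer_point_less[of n] by (simp add: breakpoint_def layer_point_last)
    next
      case 3
      have "s (2 * n - k) < s (Suc (2 * n - k))" by (rule layer_point_less) (use 3 in auto)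
      then show ?thesis using 3 k by (simp add: breakpoint_def Suc_diff_le)
    qed
  qed
  then have prems: "\<forall>k<2 * n + 1. breakpoint k < breakpoint (Suc k)" "\<forall>k<2 * n + 1. 0 < num_intervals k" using num_intervals_pos by auto
  obtain xs where xs: "sorted_wrt (<) xs" "set xs = shishkin_points n \<alpha> \<epsilon> N" "length xs = Suc N"
      "xs ! 0 = breakpoint 0" "xs ! N = breakpoint (2 * n + 1)"
      "\<And>j. j < N \<Longrightarrow> \<exists>k<2 * n + 1. breakpoint k \<le> xs ! j \<and> xs ! Suc j \<le> breakpoint (Suc k) \<and>
        xs ! Suc j - xs ! j = (breakpoint (Suc k) - breakpoint k) / real (num_intervals k)"
    using glued_uniform_meshes[OF prems] unfolding shishkin_points_eq(2)[symmetric] sum_num_intervals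
    by (elim exE conjE) blast
  have "sorted_list_of_set (shishkin_points n \<alpha> \<epsilon> N) = xs"
    unfolding xs(2)[symmetric] using xs(1)
    by (intro strict_sorted_equal) auto
  then have x: "x j = xs ! j" for j by (simp add: x_def shishkin_mesh_def)
  show "x 0 = 0" "x N = 1" using xs(4,5) n by (auto simp: x breakpoint_def layer_point_0)
  show "x j < x (Suc j)" if "j < N" for j
    unfolding x using xs(3) that by (intro sorted_wrt_nth_less[OF xs(1)]) auto
  show "\<exists>k\<le>n. s k \<le> x j \<and> s k \<le> 1 - x (Suc j) \<and> x (Suc j) - x j \<le> 2 ^ (n + 1) * s (Suc k) / real N"
    if j: "j < N" for j
  proof -
    obtain k where k: "k < 2 * n + 1" "breakpoint k \<le> x j" "x (Suc j) \<le> breakpoint (Suc k)"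
        "x (Suc j) - x j = (breakpoint (Suc k) - breakpoint k) / real (num_intervals k)"
      using xs(6)[OF j] by (auto simp: x)
    have width: "x (Suc j) - x j \<le> 2 ^ (n + 1) * B / real N" if "breakpoint (Suc k) - breakpoint k \<le> B" for B
    proof -
      have "(breakpoint (Suc k) - breakpoint k) * real N \<le> B * (2 ^ (n + 1) * real (num_intervals k))"
        using that blt[OF k(1)] num_intervals_ge[of k] by (intro mult_mono) auto
      then show ?thesis using num_intervals_pos[of k] N unfolding k(4) by (simp add: field_simps)
    qed
    consider "k < n" | "k = n" | "n < k" by linarith
    then show ?thesis
    proof cases
      case 1
      have "s k + s (Suc k) \<le> 1" using layer_point_le_half[of k] layer_point_le_half[of "Suc k"] 1 by simp
      then show ?thesis
        using 1 k width[of "s (Suc k)"] layer_point_nonneg[of k]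
        by (intro exI[of _ k]) (auto simp: breakpoint_def)
    next
      case 2
      have N0: "(0::real) < real N" using N by simp
      \<comment> \<open>The middle piece may be almost twice as long as
        \<open>s (Suc n) = 1 / 2\<close>, so \<open>width\<close> does not give this. Instead its
        \<open>N / 2\<close> intervals have length at most \<open>2 / N\<close>, and
        \<open>n \<ge> 1\<close> absorbs the factor.\<close>
      have "x (Suc j) - x j \<le> 2 ^ (n + 1) * s (Suc n) / real N"
      proof -
        have "breakpoint (Suc n) - breakpoint n \<le> 1" using layer_point_nonneg[of n] by (simp add: breakpoint_def)
        then have "x (Suc j) - x j \<le> 1 / real (num_intervals n)" unfolding k(4) 2 by (intro divide_right_mono) auto
        also have "\<dots> = 2 / real (2 * num_intervals n)" by simp
        also have "\<dots> = 2 / real N" by (simp only: num_intervals_middle)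
        also have "\<dots> \<le> 2 ^ n / real N"
          using n N0 power_increasing[of 1 n "2::real"] by (intro divide_right_mono) auto
        finally show ?thesis by (simp add: layer_point_last)
      qed
      then show ?thesis using 2 k by (intro exI[of _ n]) (auto simp: breakpoint_def)
    next
      case 3
      define l where "l = 2 * n - k"
      have l: "l < n" "breakpoint k = 1 - s (Suc l)" "breakpoint (Suc k) = 1 - s l"
        using 3 k(1) by (auto simp: l_def breakpoint_def Suc_diff_le)
      have "s l + s (Suc l) \<le> 1" using layer_point_le_half[of l] layer_point_le_half[of "Suc l"] l(1) by simp
      then show ?thesis
        using l k width[of "s (Suc l)"] layer_point_nonneg[of l]
        by (intro exI[of _ l]) auto
    qed
  qed
qed

end

section \<open>Convergence\<close>

text \<open>The leading power bounds the interval length. For each scale,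
  \<open>2 ^ (2 * n + 2)\<close> is the product of \<open>2 ^ (n + 1)\<close> from the mesh width,
  \<open>2 ^ n\<close> from \<open>layer_dichotomy\<close> and 2 for the two exponentials; the 4
  covers two exponentials of size \<open>1 / N\<close>, each at most
  \<open>2 * (ln N / N)\<close>.\<close>

definition mesh_const :: "nat \<Rightarrow> real \<Rightarrow> real" where
  "mesh_const n \<alpha> = 2 ^ (n + 1) + real n * (2 ^ (2 * n + 2) / sqrt \<alpha> + 4)"

definition error_const :: "nat \<Rightarrow> real \<Rightarrow> real \<Rightarrow> real" where
  "error_const n \<alpha> H = (H * (1 + real n * solution_bound \<alpha> H) * 2 ^ (n + 1)
    + real n * H * (osc_const n \<alpha> H * mesh_const n \<alpha>)) / \<alpha>"

text \<open>Since \<open>N \<ge> 2\<close>, the logarithm is at least \<open>2 / 3\<close>. This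
  lets quantities of order \<open>1 / N\<close> be absorbed into \<open>ln N / N\<close>.\<close>

lemma inverse_le_ln:
  assumes "1 < N"
  shows "1 / real N \<le> 2 * (ln (real N) / real N)"
proof -
  have "2 / 3 \<le> ln (real N)" using ln2_ge_two_thirds ln_le_cancel_iff[of 2 "real N"] assms by linarith
  then show ?thesis using assms by (simp add: field_simps)
qed

text \<open>The points \<open>y\<close> and \<open>z\<close> need not be mesh points: the hypotheses
  pass from a mesh interval to its subintervals, and the truncation error compares \<open>u\<close>
  at a mesh point with \<open>u\<close> at an arbitrary point next to it.\<close>

lemma (in shishkin) mesh_interval_weight:
  assumes k: "k \<le> n" "s k \<le> y" "s k \<le> 1 - z" and yz: "y \<le> z" "z - y \<le> 2 ^ (n + 1) * s (Suc k) / real N"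
  shows "z - y \<le> 2 ^ (n + 1) * (ln (real N) / real N)" (is ?step)
    and "z - y + (\<Sum>p\<in>{1..n}. min 1 ((z - y) / sqrt (\<epsilon> p)) *
      (exp (- sqrt (\<alpha> / \<epsilon> p) * y) + exp (- sqrt (\<alpha> / \<epsilon> p) * (1 - z))))
      \<le> mesh_const n \<alpha> * (ln (real N) / real N)" (is ?total)
proof -
  define \<eta> where "\<eta> = ln (real N) / real N"
  have inv: "1 / real N \<le> 2 * \<eta>" unfolding \<eta>_def by (rule inverse_le_ln[OF N])
  have \<eta>0: "0 \<le> \<eta>" using N by (simp add: \<eta>_def)
  have N0: "0 < real N" using N by simp
  have pos: "0 \<le> y" "0 \<le> 1 - z" using k layer_point_nonneg[of k] by auto
  have "z - y \<le> 2 ^ (n + 1) * (1 / 2) / real N"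
    using yz(2) layer_point_le_half[of "Suc k"] k(1) N0
    by (elim order.trans) (intro divide_right_mono mult_left_mono, auto)
  also have "\<dots> = 2 ^ n * (1 / real N)" by simp
  also have "\<dots> \<le> 2 ^ n * (2 * \<eta>)" by (intro mult_left_mono inv) auto
  finally have step: "z - y \<le> 2 ^ (n + 1) * \<eta>" by simp
  then show ?step by (simp only: \<eta>_def)
  have term_le: "min 1 ((z - y) / sqrt (\<epsilon> p)) *
      (exp (- sqrt (\<alpha> / \<epsilon> p) * y) + exp (- sqrt (\<alpha> / \<epsilon> p) * (1 - z)))
      \<le> (2 ^ (2 * n + 2) / sqrt \<alpha> + 4) * \<eta>" (is "?m * ?e \<le> _") if p: "p \<in> {1..n}" for p
  proof -
    have \<epsilon>: "0 < \<epsilon> p" by (rule eps[OF p])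
    have m: "0 \<le> ?m" using yz(1) \<epsilon> by simp
    consider "s (Suc k) \<le> 2 ^ n * (sqrt (\<epsilon> p / \<alpha>) * ln (real N))"
      | "\<And>t. s k \<le> t \<Longrightarrow> exp (- sqrt (\<alpha> / \<epsilon> p) * t) \<le> 1 / real N"
      using layer_dichotomy[OF p k(1)] by blast
    then show ?thesis
    proof cases
      case 1
      have "z - y \<le> 2 ^ (n + 1) * (2 ^ n * (sqrt (\<epsilon> p / \<alpha>) * ln (real N))) / real N"
        using yz(2) by (rule order.trans) (use 1 N0 in \<open>intro divide_right_mono mult_left_mono, auto\<close>)
      also have "\<dots> = 2 ^ (2 * n + 1) / sqrt \<alpha> * \<eta> * sqrt (\<epsilon> p)"
      proof -
        have "2 * n + 1 = (n + 1) + n" by simp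
        then have "(2::real) ^ (2 * n + 1) = 2 ^ (n + 1) * 2 ^ n" by (simp only: power_add)
        then show ?thesis by (simp only: \<eta>_def real_sqrt_divide) simp
      qed
      finally have "(z - y) / sqrt (\<epsilon> p) \<le> 2 ^ (2 * n + 1) / sqrt \<alpha> * \<eta>"
        using \<epsilon> by (simp add: divide_le_eq)
      then have "?m \<le> 2 ^ (2 * n + 1) / sqrt \<alpha> * \<eta>" by linarith
      moreover have "?e \<le> 2"
      proof -
        have "0 \<le> sqrt (\<alpha> / \<epsilon> p) * y" "0 \<le> sqrt (\<alpha> / \<epsilon> p) * (1 - z)"
          using pos \<alpha> \<epsilon> by (auto intro!: mult_nonneg_nonneg)
        then have "exp (- sqrt (\<alpha> / \<epsilon> p) * y) \<le> 1" "exp (- sqrt (\<alpha> / \<epsilon> p) * (1 - z)) \<le> 1"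
          by simp_all
        then show ?thesis by linarith
      qed
      ultimately have "?m * ?e \<le> 2 ^ (2 * n + 1) / sqrt \<alpha> * \<eta> * 2"
        using m by (intro mult_mono) (auto intro: add_nonneg_nonneg)
      also have "\<dots> \<le> (2 ^ (2 * n + 2) / sqrt \<alpha> + 4) * \<eta>" using \<eta>0 by (simp add: distrib_right)
      finally show ?thesis .
    next
      case 2
      have "?e \<le> 1 / real N + 1 / real N" by (intro add_mono 2 k)
      then have "?e \<le> 4 * \<eta>" using inv by linarith
      then have "?m * ?e \<le> 1 * (4 * \<eta>)"
        using m by (intro mult_mono) (auto intro: add_nonneg_nonneg)
      also have "\<dots> \<le> (2 ^ (2 * n + 2) / sqrt \<alpha> + 4) * \<eta>" using \<eta>0 \<alpha> by (simp add: distrib_right)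
      finally show ?thesis .
    qed
  qed
  show ?total
    using add_mono[OF step sum_bounded_above[of "{1..n}", OF term_le]]
    by (simp add: mesh_const_def \<eta>_def[symmetric] algebra_simps)
qed

lemma error_le:
  assumes rd: "reaction_diffusion n a f \<alpha> H \<epsilon> u u' u''"
    and ends: "\<And>i. i \<in> {1..n} \<Longrightarrow> u i 0 = u0 i" "\<And>i. i \<in> {1..n} \<Longrightarrow> u i 1 = u1 i"
    and N: "1 < N" and adm: "admissible n N"
    and U: "scheme_solution n a f u0 u1 \<epsilon> N (shishkin_mesh n \<alpha> \<epsilon> N) U"
    and i: "i \<in> {1..n}" and j: "j \<le> N"
  shows "\<bar>U i j - u i (shishkin_mesh n \<alpha> \<epsilon> N j)\<bar> \<le> error_const n \<alpha> H * (ln (real N) / real N)"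
proof -
  interpret reaction_diffusion n a f \<alpha> H \<epsilon> u u' u'' by (rule rd)
  interpret mesh: shishkin n \<alpha> \<epsilon> N
    using n \<alpha> eps eps_mono N adm by unfold_locales auto
  define x where "x = shishkin_mesh n \<alpha> \<epsilon> N"
  define \<eta> where "\<eta> = ln (real N) / real N"
  have \<eta>0: "0 \<le> \<eta>" using N by (simp add: \<eta>_def)
  note x = mesh.shishkin_mesh_properties[folded x_def]
  have range: "0 \<le> x m" "x (Suc m) \<le> 1" if m: "m < N" for m
  proof -
    obtain k where "k \<le> n" "mesh.s k \<le> x m" "mesh.s k \<le> 1 - x (Suc m)" using x(4)[OF m] by blast
    then show "0 \<le> x m" "x (Suc m) \<le> 1" using mesh.layer_point_nonneg[of k] by linarith+
  qed
  have K0: "0 \<le> osc_const n \<alpha> H"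
    using H_pos \<alpha> solution_bound_pos slope_const_pos by (simp add: osc_const_def)
  have sub: "z - y \<le> 2 ^ (n + 1) * \<eta>" "\<bar>u l z - u l y\<bar> \<le> osc_const n \<alpha> H * (mesh_const n \<alpha> * \<eta>)"
    if m: "m < N" and yz: "x m \<le> y" "y \<le> z" "z \<le> x (Suc m)" and l: "l \<in> {1..n}" for m y z l
  proof -
    obtain k where k: "k \<le> n" "mesh.s k \<le> x m" "mesh.s k \<le> 1 - x (Suc m)"
        "x (Suc m) - x m \<le> 2 ^ (n + 1) * mesh.s (Suc k) / real N"
      using x(4)[OF m] by blast
    have k': "mesh.s k \<le> y" "mesh.s k \<le> 1 - z" "z - y \<le> 2 ^ (n + 1) * mesh.s (Suc k) / real N"
      using k yz by linarith+
    note w = mesh.mesh_interval_weight[OF k(1) k'(1,2) yz(2) k'(3), folded \<eta>_def]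
    show "z - y \<le> 2 ^ (n + 1) * \<eta>" by (rule w(1))
    have "\<bar>u l (y + (z - y)) - u l y\<bar> \<le> osc_const n \<alpha> H * (z - y + (\<Sum>p\<in>{1..n}.
      min 1 ((z - y) / sqrt (\<epsilon> p)) * (exp (- sqrt (\<alpha> / \<epsilon> p) * y)
        + exp (- sqrt (\<alpha> / \<epsilon> p) * (1 - (y + (z - y)))))))"
      by (rule oscillation_le[OF l]) (use yz range[OF m] in auto)
    also have "y + (z - y) = z" by simp
    finally show "\<bar>u l z - u l y\<bar> \<le> osc_const n \<alpha> H * (mesh_const n \<alpha> * \<eta>)"
      by (rule order.trans) (intro mult_left_mono w(2) K0)
  qed
  define \<tau> where "\<tau> = H * (1 + real n * solution_bound \<alpha> H) * (2 ^ (n + 1) * \<eta>)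
    + real n * H * (osc_const n \<alpha> H * (mesh_const n \<alpha> * \<eta>))"
  have trunc: "\<bar>- \<epsilon> l * delta2 x (\<lambda>m. u l (x m)) m + (\<Sum>q\<in>{1..n}. a l q (x m) * u q (x m)) - f l (x m)\<bar> \<le> \<tau>"
    if l: "l \<in> {1..n}" and m: "m \<in> {1..N - 1}" for l m
    unfolding \<tau>_def
  proof (rule truncation_error_le[OF l])
    have mN: "m - 1 < N" "m < N" "Suc (m - 1) = m" using m by auto
    show "0 \<le> x (m - 1)" "x (m - 1) < x m" "x m < x (m + 1)" "x (m + 1) \<le> 1"
      using range[OF mN(1)] range[OF mN(2)] x(3)[OF mN(1)] x(3)[OF mN(2)] mN(3) by simp_all
    then show "x m - x (m - 1) \<le> 2 ^ (n + 1) * \<eta>" "x (m + 1) - x m \<le> 2 ^ (n + 1) * \<eta>"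
      using sub(1)[OF mN(1) _ _ _ l, of "x (m - 1)" "x m"] sub(1)[OF mN(2) _ _ _ l, of "x m" "x (m + 1)"] mN(3)
      by simp_all
    fix q t assume q: "q \<in> {1..n}" and t: "t \<in> {x (m - 1)..x (m + 1)}"
    show "\<bar>u q t - u q (x m)\<bar> \<le> osc_const n \<alpha> H * (mesh_const n \<alpha> * \<eta>)"
    proof (cases "t \<le> x m")
      case True
      then show ?thesis using sub(2)[OF mN(1) _ _ _ q, of t "x m"] t mN(3) by (simp add: abs_minus_commute)
    next
      case False
      then show ?thesis using sub(2)[OF mN(2) _ _ _ q, of "x m" t] t by simp
    qed
  qed
  have scheme: "U l 0 = u0 l" "U l N = u1 l"
    "m \<in> {1..N - 1} \<Longrightarrow> - \<epsilon> l * delta2 x (U l) m + (\<Sum>q\<in>{1..n}. a l q (x m) * U q m) = f l (x m)"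
    if "l \<in> {1..n}" for l m
    using U that by (auto simp: scheme_solution_def x_def[symmetric])
  have xI: "x m \<in> {0..1}" if "m \<in> {1..N - 1}" for m
    using range[of m] range[of "m - 1"] that by auto
  have "\<bar>U i j - u i (x j)\<bar> \<le> \<tau> / \<alpha>"
  proof (rule discrete_stability[where V = "\<lambda>i j. U i j - u i (x j)" and b = "\<lambda>i k j. a i k (x j)"
        and x = x and \<epsilon> = \<epsilon> and N = N, OF _ x(3) _ _ _ eps(1) off row \<alpha> _ i j])
    fix l assume l: "l \<in> {1..n}"
    show "U l 0 - u l (x 0) = 0" "U l N - u l (x N) = 0"
      using scheme(1,2)[OF l] ends[OF l] x(1,2) by auto
    fix m assume m: "m \<in> {1..N - 1}"
    \<comment> \<open>\<open>U\<close> satisfies the scheme exactly, so the residual of the error is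
      minus the truncation error.\<close>
    have "- \<epsilon> l * delta2 x (\<lambda>j. U l j - u l (x j)) m + (\<Sum>q\<in>{1..n}. a l q (x m) * (U q m - u q (x m)))
      = - (- \<epsilon> l * delta2 x (\<lambda>m. u l (x m)) m + (\<Sum>q\<in>{1..n}. a l q (x m) * u q (x m)) - f l (x m))"
      unfolding delta2_diff using scheme(3)[OF l m] by (simp add: algebra_simps sum_subtractf)
    then show "\<bar>- \<epsilon> l * delta2 x (\<lambda>j. U l j - u l (x j)) m
        + (\<Sum>q\<in>{1..n}. a l q (x m) * (U q m - u q (x m)))\<bar> \<le> \<tau>"
      using trunc[OF l m] by (simp only: abs_minus_cancel)
  next
    have "0 \<le> mesh_const n \<alpha>" using \<alpha> by (simp add: mesh_const_def)
    then show "0 \<le> \<tau>"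
      unfolding \<tau>_def using H_pos solution_bound_pos K0 \<eta>0 by simp
  qed (use xI in auto)
  also have "\<tau> / \<alpha> = error_const n \<alpha> H * \<eta>"
    by (simp add: \<tau>_def error_const_def algebra_simps add_divide_distrib)
  finally show ?thesis by (simp only: x_def \<eta>_def)
qed

section \<open>A common bound for the data\<close>

definition bounded_lipschitz :: "real \<Rightarrow> (real \<Rightarrow> real) \<Rightarrow> bool" where
  "bounded_lipschitz B g \<longleftrightarrow> (\<forall>x\<in>{0..1}. \<bar>g x\<bar> \<le> B) \<and>
    (\<forall>x\<in>{0..1}. \<forall>y\<in>{0..1}. \<bar>g x - g y\<bar> \<le> B * \<bar>x - y\<bar>)"

lemma bounded_lipschitz_mono: "bounded_lipschitz B g \<Longrightarrow> B \<le> B' \<Longrightarrow> bounded_lipschitz B' g"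
  unfolding bounded_lipschitz_def by (meson abs_ge_zero mult_right_mono order.trans)

lemma Ck_on_1_imp_bounded_lipschitz:
  assumes "Ck_on 1 0 1 g"
  shows "\<exists>B. bounded_lipschitz B g"
proof -
  obtain D where "\<forall>x\<in>{0..1}. D 0 x = g x"
      "\<forall>m<1. \<forall>x\<in>{0..1}. (D m has_real_derivative D (Suc m) x) (at x within {0..1})"
      "\<forall>m\<le>1. continuous_on {0..1} (D m)"
    using assms unfolding Ck_on_def by blast
  then have D: "\<And>x. x \<in> {0..1} \<Longrightarrow> D 0 x = g x"
      "\<And>x. x \<in> {0..1} \<Longrightarrow> (D 0 has_real_derivative D (Suc 0) x) (at x within {0..1})"
      "continuous_on {0..1} (D 0)" "continuous_on {0..1} (D (Suc 0))"
    by auto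
  obtain B0 where B0: "\<And>x. x \<in> {0..1} \<Longrightarrow> norm (D 0 x) \<le> B0"
    by (rule continuous_on_compact_bound[OF compact_Icc D(3)]) blast
  obtain B1 where B1: "\<And>x. x \<in> {0..1} \<Longrightarrow> norm (D (Suc 0) x) \<le> B1"
    by (rule continuous_on_compact_bound[OF compact_Icc D(4)]) blast
  have "norm (D 0 x - D 0 y) \<le> max B0 B1 * norm (x - y)" if "x \<in> {0..1}" "y \<in> {0..1}" for x y
    by (rule field_differentiable_bound[OF _ D(2)])
       (use B1 that in \<open>auto intro: le_max_iff_disj[THEN iffD2]\<close>)
  then show ?thesis
    using B0 D(1) unfolding bounded_lipschitz_def
    by (intro exI[of _ "max B0 B1"]) (auto intro: le_max_iff_disj[THEN iffD2])
qed

lemma problem_data_bound: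
  assumes "problem_data n 1 a f \<alpha>"
  obtains H where "\<forall>i\<in>{1..n}. \<forall>j\<in>{1..n}. bounded_lipschitz H (a i j)"
    "\<forall>i\<in>{1..n}. bounded_lipschitz H (f i) \<and> \<bar>u0 i\<bar> \<le> H \<and> \<bar>u1 i\<bar> \<le> H"
proof -
  define A where "A i j = (SOME B. bounded_lipschitz B (a i j))" for i j
  define F where "F i = (SOME B. bounded_lipschitz B (f i))" for i
  have A: "bounded_lipschitz (A i j) (a i j)" if "i \<in> {1..n}" "j \<in> {1..n}" for i j
    unfolding A_def
    by (rule someI_ex, rule Ck_on_1_imp_bounded_lipschitz) (use assms that in \<open>auto simp: problem_data_def\<close>)
  have F: "bounded_lipschitz (F i) (f i)" if "i \<in> {1..n}" for i
    unfolding F_def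
    by (rule someI_ex, rule Ck_on_1_imp_bounded_lipschitz) (use assms that in \<open>auto simp: problem_data_def\<close>)
  define S where "S = (\<lambda>(i, j). A i j) ` ({1..n} \<times> {1..n}) \<union> F ` {1..n}
    \<union> (\<lambda>i. \<bar>u0 i\<bar>) ` {1..n} \<union> (\<lambda>i. \<bar>u1 i\<bar>) ` {1..n}"
  have le: "t \<le> Max S" if "t \<in> S" for t
    using that by (intro Max_ge) (auto simp: S_def)
  have "bounded_lipschitz (Max S) (a i j)" if "i \<in> {1..n}" "j \<in> {1..n}" for i j
    by (rule bounded_lipschitz_mono[OF A[OF that] le]) (use that in \<open>force simp: S_def\<close>)
  moreover have "bounded_lipschitz (Max S) (f i)" "\<bar>u0 i\<bar> \<le> Max S" "\<bar>u1 i\<bar> \<le> Max S"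
    if "i \<in> {1..n}" for i
    by (rule bounded_lipschitz_mono[OF F[OF that] le] le, use that in \<open>force simp: S_def\<close>)+
  ultimately show ?thesis by (intro that[of "Max S"]) auto
qed

theorem theorem1:
  fixes n :: nat
  assumes "n \<ge> 1"
  shows "\<exists>k :: nat.
    \<forall>(a :: nat \<Rightarrow> nat \<Rightarrow> real \<Rightarrow> real) (f :: nat \<Rightarrow> real \<Rightarrow> real) (\<alpha> :: real)
      (u0 :: nat \<Rightarrow> real) (u1 :: nat \<Rightarrow> real).
    problem_data n k a f \<alpha> \<longrightarrow>
    (\<exists>C :: real.
      \<forall>(\<epsilon> :: nat \<Rightarrow> real) (N :: nat) (u :: nat \<Rightarrow> real \<Rightarrow> real) (U :: nat \<Rightarrow> nat \<Rightarrow> real).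
        perturbation_params n \<alpha> \<epsilon> \<longrightarrow>
        N > 1 \<longrightarrow> admissible n N \<longrightarrow>
        bvp_solution n a f u0 u1 \<epsilon> u \<longrightarrow>
        scheme_solution n a f u0 u1 \<epsilon> N (shishkin_mesh n \<alpha> \<epsilon> N) U \<longrightarrow>
        max_error n N (shishkin_mesh n \<alpha> \<epsilon> N) U u \<le> C * inverse (real N) * ln (real N))"
\<comment> \<open>One continuous derivative on the closed interval supplies bounds and Lipschitz
  constants, and these are the form in which \<open>A\<close> and \<open>f\<close> enter the
  estimates.\<close>
proof (intro exI[of _ "1::nat"] allI impI)
  fix a :: "nat \<Rightarrow> nat \<Rightarrow> real \<Rightarrow> real" and f :: "nat \<Rightarrow> real \<Rightarrow> real" and \<alpha> :: real and u0 u1 :: "nat \<Rightarrow> real"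
  assume pd: "problem_data n 1 a f \<alpha>"
  obtain H where "\<forall>i\<in>{1..n}. \<forall>j\<in>{1..n}. bounded_lipschitz H (a i j)"
      "\<forall>i\<in>{1..n}. bounded_lipschitz H (f i) \<and> \<bar>u0 i\<bar> \<le> H \<and> \<bar>u1 i\<bar> \<le> H"
    by (rule problem_data_bound[OF pd])
  then have H: "i \<in> {1..n} \<Longrightarrow> j \<in> {1..n} \<Longrightarrow> bounded_lipschitz H (a i j)"
      "i \<in> {1..n} \<Longrightarrow> bounded_lipschitz H (f i)"
      "i \<in> {1..n} \<Longrightarrow> \<bar>u0 i\<bar> \<le> H" "i \<in> {1..n} \<Longrightarrow> \<bar>u1 i\<bar> \<le> H" for i j
    by auto
  show "\<exists>C. \<forall>\<epsilon> N u U. perturbation_params n \<alpha> \<epsilon> \<longrightarrow> N > 1 \<longrightarrow> admissible n N \<longrightarrow>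
        bvp_solution n a f u0 u1 \<epsilon> u \<longrightarrow>
        scheme_solution n a f u0 u1 \<epsilon> N (shishkin_mesh n \<alpha> \<epsilon> N) U \<longrightarrow>
        max_error n N (shishkin_mesh n \<alpha> \<epsilon> N) U u \<le> C * inverse (real N) * ln (real N)"
  \<comment> \<open>\<open>H\<close> has been obtained from the data before
    \<open>\<epsilon>\<close>, \<open>N\<close>, \<open>u\<close> and \<open>U\<close> are
    introduced, which is the claimed uniformity.\<close>
  proof (intro exI[of _ "error_const n \<alpha> H"] allI impI)
    fix \<epsilon> :: "nat \<Rightarrow> real" and N :: nat and u :: "nat \<Rightarrow> real \<Rightarrow> real" and U :: "nat \<Rightarrow> nat \<Rightarrow> real"
    assume pp: "perturbation_params n \<alpha> \<epsilon>" and N: "1 < N" and adm: "admissible n N"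
      and u: "bvp_solution n a f u0 u1 \<epsilon> u"
      and U: "scheme_solution n a f u0 u1 \<epsilon> N (shishkin_mesh n \<alpha> \<epsilon> N) U"
    have ub: "continuous_on {0..1} (u i)" "u i 0 = u0 i" "u i 1 = u1 i" if "i \<in> {1..n}" for i
      using u that by (auto simp: bvp_solution_def)
    have "\<forall>i\<in>{1..n}. \<exists>u' u''. \<forall>x\<in>{0<..<1}. (u i has_real_derivative u' x) (at x) \<and>
        (u' has_real_derivative u'' x) (at x) \<and> - \<epsilon> i * u'' x + (\<Sum>j\<in>{1..n}. a i j x * u j x) = f i x"
      using u by (auto simp: bvp_solution_def)
    then obtain u' u'' where u'': "\<forall>i\<in>{1..n}. \<forall>x\<in>{0<..<1}. (u i has_real_derivative u' i x) (at x) \<and> (u' i has_real_derivative u'' i x) (at x) \<and>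
        - \<epsilon> i * u'' i x + (\<Sum>j\<in>{1..n}. a i j x * u j x) = f i x"
      unfolding bchoice_iff by blast
    have rd: "reaction_diffusion n a f \<alpha> H \<epsilon> u u' u''"
    proof
      show "1 \<le> n" by (rule assms)
      show "0 < \<alpha>" using pd by (simp add: problem_data_def)
      show "strict_mono_on {1..n} \<epsilon>" using pp by (simp add: perturbation_params_def)
      fix i assume i: "i \<in> {1..n}"
      show "0 < \<epsilon> i" "\<epsilon> i \<le> 1" using pp i by (auto simp: perturbation_params_def)
      show "continuous_on {0..1} (u i)" "\<bar>u i 0\<bar> \<le> H" "\<bar>u i 1\<bar> \<le> H"
        using ub[OF i] H(3,4)[OF i] by auto
      fix x :: real
      show "\<alpha> < (\<Sum>j\<in>{1..n}. a i j x)" if "x \<in> {0..1}"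
        using pd i that by (simp add: problem_data_def)
      show "(u i has_real_derivative u' i x) (at x)" "(u' i has_real_derivative u'' i x) (at x)"
        "- \<epsilon> i * u'' i x + (\<Sum>j\<in>{1..n}. a i j x * u j x) = f i x" if "x \<in> {0<..<1}"
        using u'' i that by blast+
      show "a i j x \<le> 0" if "j \<in> {1..n}" "i \<noteq> j" "x \<in> {0..1}" for j
        using pd i that by (simp add: problem_data_def)
      show "\<bar>f i x\<bar> \<le> H" if "x \<in> {0..1}"
        using H(2)[OF i] that by (simp add: bounded_lipschitz_def)
      show "\<bar>f i x - f i y\<bar> \<le> H * \<bar>x - y\<bar>" if "x \<in> {0..1}" "y \<in> {0..1}" for y
        using H(2)[OF i] that by (simp add: bounded_lipschitz_def)
      fix j assume j: "j \<in> {1..n}"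
      show "\<bar>a i j x\<bar> \<le> H" if "x \<in> {0..1}"
        using H(1)[OF i j] that by (simp add: bounded_lipschitz_def)
      show "\<bar>a i j x - a i j y\<bar> \<le> H * \<bar>x - y\<bar>" if "x \<in> {0..1}" "y \<in> {0..1}" for y
        using H(1)[OF i j] that by (simp add: bounded_lipschitz_def)
    qed
    have "\<bar>U i j - u i (shishkin_mesh n \<alpha> \<epsilon> N j)\<bar> \<le> error_const n \<alpha> H * (ln (real N) / real N)"
      if "i \<in> {1..n}" "j \<in> {0..N}" for i j
      by (rule error_le[OF rd ub(2,3) N adm U]) (use that in auto)
    then have "max_error n N (shishkin_mesh n \<alpha> \<epsilon> N) U u \<le> error_const n \<alpha> H * (ln (real N) / real N)"
      unfolding max_error_def using assms by (auto intro!: Max.boundedI)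
    then show "max_error n N (shishkin_mesh n \<alpha> \<epsilon> N) U u \<le> error_const n \<alpha> H * inverse (real N) * ln (real N)"
      by (simp add: field_simps)
  qed
qed

end
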